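(* Let $A_1,B_1,\dots,A_n,B_n\subset\mathbb{R}^n$ be centrally symmetric convex bodies. If for all $u_1,\dots,u_n\in SL_n(\mathbb{R})$ one has $$V(u_1A_1,\dots,u_nA_n)\le V(u_1B_1,\dots,u_nB_n),$$ then there exist positive constants $t_1,\dots,t_n$ such that $\prod_{i=1}^n t_i=1$ and $A_i\subseteq t_iB_i$ for every $1\le i\le n$.
   Context: A convex body in $\mathbb{R}^n$ is a compact convex set with non-empty interior. A convex body $K$ is centrally symmetric if $K=-K$. $V$ denotes the $n$-dimensional mixed volume. *)

theory Defs
  imports "HOL-Analysis.Analysis"
begin

definition convex_body :: "'a::euclidean_space set \<Rightarrow> bool" where
  "convex_body K \<longleftrightarrow> compact K \<and> convex K \<and> interior K \<noteq> {}"

definition centrally_symmetric :: "'a::real_vector set \<Rightarrow> bool" where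
  "centrally_symmetric K \<longleftrightarrow> K = uminus ` K"

text \<open>
  By Minkowski's theorem there is exactly one symmetric functional \<open>V\<close> on \<open>n\<close>-tuples of convex
  bodies in \<open>n\<close>-dimensional space such that
  \[ \mathrm{vol}(c_1 K_1 + \dots + c_m K_m) =
     \sum_{i_1, \dots, i_n = 1}^m V(K_{i_1}, \dots, K_{i_n})\, c_{i_1} \cdots c_{i_n} \]
  for all \<open>m\<close>, all convex bodies \<open>K\<^sub>j\<close> and all \<open>c\<^sub>j \<ge> 0\<close>; it is called the mixed volume.

  An \<open>n\<close>-tuple is indexed by the coordinate type \<open>'n\<close>, so the multi-indices
  \<open>(i\<^sub>1, \<dots>, i\<^sub>n)\<close> are the functions \<open>f\<close> from \<open>'n\<close> to \<open>{..<m}\<close>.  The sum of sets below is the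
  Minkowski sum.  The value on tuples that do not consist of convex bodies is fixed
  (to \<open>undefined\<close>) only to make \<open>V\<close> unique as a total function.
\<close>

definition is_mixed_volume :: "(('n::finite \<Rightarrow> (real^'n) set) \<Rightarrow> real) \<Rightarrow> bool" where
  "is_mixed_volume V \<longleftrightarrow>
     V \<in> extensional {K. \<forall>i. convex_body (K i)} \<and>
     (\<forall>K \<pi>. (\<forall>i. convex_body (K i)) \<and> \<pi> permutes UNIV \<longrightarrow> V (K \<circ> \<pi>) = V K) \<and>
     (\<forall>(m::nat) (K :: nat \<Rightarrow> (real^'n) set) (c :: nat \<Rightarrow> real).
        (\<forall>j<m. convex_body (K j) \<and> 0 \<le> c j) \<longrightarrow>
        measure lebesgue (\<Sum>j<m. (*\<^sub>R) (c j) ` K j) =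
          (\<Sum>f\<in>UNIV \<rightarrow> {..<m}. V (\<lambda>i. K (f i)) * (\<Prod>i\<in>UNIV. c (f i))))"

definition mixed_volume :: "('n::finite \<Rightarrow> (real^'n) set) \<Rightarrow> real" where
  "mixed_volume = (THE V. is_mixed_volume V)"

end

theory Submission
  imports Defs
begin

text \<open>
  The mixed volume exists because the volume of a Minkowski sum is a determinant integrated over
  space.  For a polytope \<open>conv F\<close> the gradient of \<open>x \<mapsto> ln (\<Sum>v\<in>F. exp (v \<bullet> x))\<close> is a diffeomorphism
  onto the interior of \<open>conv F\<close>, and nonnegative combinations of such functions parametrise the
  corresponding Minkowski combinations.  By the change of variables formula,
  \<open>vol (\<Sum>\<^sub>j c\<^sub>j conv F\<^sub>j) = \<integral> det (\<Sum>\<^sub>j c\<^sub>j H\<^sub>j(x)) dx\<close> with \<open>H\<^sub>j\<close> the Hessians.  The integrand is a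
  homogeneous polynomial in the \<open>c\<^sub>j\<close> whose coefficients are given by polarization, so
  the same holds for the volume; approximation by polytopes extends this to convex bodies, with
  the polarized volume as mixed volume.

  For the theorem, let \<open>u\<^sub>i\<close> degenerate to a multiple of the rank one map \<open>x \<mapsto> (\<xi>\<^sub>i \<bullet> x) e\<^sub>i\<close>.  After
  rescaling, \<open>u\<^sub>i A\<^sub>i\<close> tends to a segment of half-length \<open>h\<^bsub>A\<^sub>i\<^esub>(\<xi>\<^sub>i)\<close> in direction \<open>e\<^sub>i\<close>, so the
  hypothesis becomes \<open>\<Prod>\<^sub>i h\<^bsub>A\<^sub>i\<^esub>(\<xi>\<^sub>i) \<le> \<Prod>\<^sub>i h\<^bsub>B\<^sub>i\<^esub>(\<xi>\<^sub>i)\<close> for all \<open>\<xi>\<^sub>i\<close>.  Hence the suprema \<open>s\<^sub>i\<close> of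
  \<open>h\<^bsub>A\<^sub>i\<^esub> / h\<^bsub>B\<^sub>i\<^esub>\<close> satisfy \<open>\<Prod>\<^sub>i s\<^sub>i \<le> 1\<close>, while \<open>A\<^sub>i \<subseteq> s\<^sub>i B\<^sub>i\<close> by separation.
\<close>

section \<open>Polarization\<close>

lemma sum_Pow_alternating:
  assumes "finite A"
  shows "(\<Sum>X\<in>Pow A. (-1::real) ^ card X) = (if A = {} then 1 else 0)"
proof -
  have "(\<Sum>X\<in>Pow A. (-1::real) ^ card X) = (\<Prod>x\<in>A. - 1 + (1::real))"
    using prod_add[OF assms, of "\<lambda>_. - 1::real" "\<lambda>_. 1"] by simp
  then show ?thesis
    using assms by (auto simp: card_gt_0_iff)
qed

text \<open>The polarization formula: if \<open>p S\<close> is the value of a form of degree n at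
  the sum of the vectors with index in \<open>S\<close>, this recovers the associated symmetric
  n-linear form at the n vectors.\<close>

definition polar :: "('n::finite set \<Rightarrow> real) \<Rightarrow> real" where
  "polar p = (\<Sum>S\<in>UNIV. (-1) ^ card (- S) * p S) / fact CARD('n)"

lemma surj_iff_permutes_UNIV: "range f = UNIV \<longleftrightarrow> f permutes UNIV" for f :: "'n::finite \<Rightarrow> 'n"
  by (metis UNIV_I bij_betw_def bij_imp_permutes finite_UNIV_surj_inj finite permutes_surj)

text \<open>
  Inclusion-exclusion over the range of \<open>f\<close> leaves only the surjective multi-indices.
\<close>

lemma polar_expansion:
  fixes p :: "'n::finite set \<Rightarrow> real"
  assumes "\<And>S. p S = (\<Sum>f\<in>UNIV \<rightarrow> S. G f)"
  shows "polar p = (\<Sum>\<pi> | \<pi> permutes UNIV. G \<pi>) / fact CARD('n)"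
proof -
  have alt: "(\<Sum>S | range f \<subseteq> S. (-1::real) ^ card (- S)) = (if f permutes UNIV then 1 else 0)"
    for f :: "'n \<Rightarrow> 'n"
  proof -
    have "(\<Sum>S | range f \<subseteq> S. (-1::real) ^ card (- S)) = (\<Sum>X\<in>Pow (- range f). (-1) ^ card X)"
      by (rule sum.reindex_bij_witness[of _ uminus uminus]) auto
    also have "\<dots> = (if - range f = {} then 1 else 0)"
      by (rule sum_Pow_alternating) simp
    also have "- range f = {} \<longleftrightarrow> f permutes UNIV"
      using surj_iff_permutes_UNIV[of f] by auto
    finally show ?thesis .
  qed
  have "(\<Sum>S\<in>UNIV. (-1) ^ card (- S) * p S) =
      (\<Sum>S\<in>UNIV. \<Sum>f\<in>UNIV. if range f \<subseteq> S then (-1) ^ card (- S) * G f else 0)"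
  proof (rule sum.cong[OF refl])
    fix S :: "'n set"
    have *: "UNIV \<rightarrow> S = {f \<in> UNIV. range f \<subseteq> S}" by auto
    show "(-1) ^ card (- S) * p S =
        (\<Sum>f\<in>UNIV. if range f \<subseteq> S then (-1) ^ card (- S) * G f else 0)"
      unfolding assms * sum_distrib_left by (subst sum.inter_filter) auto
  qed
  also have "\<dots> = (\<Sum>f\<in>UNIV. \<Sum>S\<in>UNIV. if range f \<subseteq> S then (-1) ^ card (- S) * G f else 0)"
    by (rule sum.swap)
  also have "\<dots> = (\<Sum>f\<in>UNIV. (\<Sum>S | range f \<subseteq> S. (-1) ^ card (- S)) * G f)"
    by (simp add: sum.inter_filter[symmetric] sum_distrib_right)
  also have "\<dots> = (\<Sum>f\<in>UNIV. if f permutes UNIV then G f else 0)"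
    unfolding alt by (intro sum.cong) auto
  also have "\<dots> = (\<Sum>\<pi> | \<pi> permutes UNIV. G \<pi>)"
    by (simp add: sum.inter_filter[symmetric])
  finally show ?thesis by (simp add: polar_def)
qed

text \<open>Serves two purposes: symmetry of the polarized volume, with \<open>h\<close> a
  permutation, and the change of coordinate type, with \<open>h\<close> a bijection between
  types.\<close>

lemma polar_reindex:
  fixes p :: "'n::finite set \<Rightarrow> real" and h :: "'m::finite \<Rightarrow> 'n"
  assumes "bij h"
  shows "polar (\<lambda>S. p (h ` S)) = polar p"
proof -
  have "bij_betw ((`) h) UNIV UNIV"
    using assms by (metis bij_betw_Pow Pow_UNIV)
  then have "(\<Sum>S\<in>UNIV. (-1) ^ card (- S) * p S) = (\<Sum>S\<in>UNIV. (-1) ^ card (- (h ` S)) * p (h ` S))"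
    by (subst sum.reindex_bij_betw) auto
  also have "\<dots> = (\<Sum>S\<in>UNIV. (-1) ^ card (- S) * p (h ` S))"
    using assms by (intro sum.cong refl)
      (metis bij_image_Compl_eq bij_is_inj card_image inj_on_subset subset_UNIV)
  finally show ?thesis
    using bij_betw_same_card[OF assms] by (simp add: polar_def)
qed

text \<open>Precomposing with a permutation permutes the multi-indices and leaves the monomial in
  \<open>c\<close> unchanged, so the coefficients may be averaged over all permutations.\<close>

lemma sum_funcset_polarized:
  fixes G :: "('n::finite \<Rightarrow> 'b) \<Rightarrow> real" and c :: "'b \<Rightarrow> real"
  shows "(\<Sum>f\<in>UNIV \<rightarrow> I. (\<Prod>i\<in>UNIV. c (f i)) * G f) =
    (\<Sum>f\<in>UNIV \<rightarrow> I. (\<Prod>i\<in>UNIV. c (f i)) * ((\<Sum>\<pi> | \<pi> permutes UNIV. G (f \<circ> \<pi>)) / fact CARD('n)))"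
    (is "?L = ?R")
proof -
  have *: "(\<Sum>f\<in>UNIV \<rightarrow> I. (\<Prod>i\<in>UNIV. c (f i)) * G (f \<circ> \<pi>)) = ?L"
    if "\<pi> permutes UNIV" for \<pi>
  proof (rule sum.reindex_bij_witness[of _ "\<lambda>f. f \<circ> inv \<pi>" "\<lambda>f. f \<circ> \<pi>"])
    fix f assume "f \<in> (UNIV :: 'n set) \<rightarrow> I"
    show "(\<Prod>i\<in>UNIV. c ((f \<circ> \<pi>) i)) * G (f \<circ> \<pi>) = (\<Prod>i\<in>UNIV. c (f i)) * G (f \<circ> \<pi>)"
      using prod.permute[OF that, of "\<lambda>i. c (f i)"] by (simp add: o_def)
  qed (use that in \<open>auto simp: o_assoc[symmetric] permutes_inv_o\<close>)
  have "?R = (\<Sum>f\<in>UNIV \<rightarrow> I. \<Sum>\<pi> | \<pi> permutes UNIV. (\<Prod>i\<in>UNIV. c (f i)) * G (f \<circ> \<pi>)) / fact CARD('n)"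
    by (simp add: sum_distrib_left sum_divide_distrib)
  also have "\<dots> = (\<Sum>\<pi> | \<pi> permutes UNIV. \<Sum>f\<in>UNIV \<rightarrow> I. (\<Prod>i\<in>UNIV. c (f i)) * G (f \<circ> \<pi>)) / fact CARD('n)"
    by (subst sum.swap) simp
  also have "\<dots> = (\<Sum>\<pi> | \<pi> permutes (UNIV::'n set). ?L) / fact CARD('n)"
    by (simp add: *)
  also have "\<dots> = ?L"
    by (simp add: card_permutations)
  finally show ?thesis by simp
qed

section \<open>Determinants of linear combinations of matrices\<close>

lemma det_sum_rows:
  fixes a :: "'n::finite \<Rightarrow> 'b \<Rightarrow> real^'n"
  assumes "finite I"
  shows "det (\<chi> i. \<Sum>k\<in>I. a i k) = (\<Sum>f\<in>UNIV \<rightarrow> I. det (\<chi> i. a i (f i)))"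
proof -
  have "(\<Prod>i\<in>UNIV. (\<Sum>k\<in>I. a i k) $ \<pi> i) = (\<Sum>f\<in>UNIV \<rightarrow> I. \<Prod>i\<in>UNIV. a i (f i) $ \<pi> i)"
    for \<pi> :: "'n \<Rightarrow> 'n"
    using prod_sum_PiE[of UNIV "\<lambda>_. I" "\<lambda>i k. a i k $ \<pi> i"] assms
    by (simp add: PiE_UNIV_domain)
  then show ?thesis
    unfolding det_def by (simp add: sum_distrib_left) (rule sum.swap)
qed

text \<open>Multilinearity in the rows gives unsymmetric coefficients; averaging them turns each
  into a mixed discriminant, written as a polarization so that it can later be integrated termwise
  into a polarized volume.\<close>

lemma det_linear_combination:
  fixes M :: "'b \<Rightarrow> real^'n::finite^'n"
  assumes "finite I"
  shows "det (\<Sum>j\<in>I. c j *\<^sub>R M j) =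
    (\<Sum>f\<in>(UNIV :: 'n set) \<rightarrow> I. (\<Prod>i\<in>UNIV. c (f i)) * polar (\<lambda>S. det (\<Sum>i\<in>S. M (f i))))"
proof -
  have rows: "(\<Sum>j\<in>J. N j) = (\<chi> i. \<Sum>j\<in>J. N j $ i)" for J and N :: "'d \<Rightarrow> real^'n^'n"
    by (simp add: vec_eq_iff)
  have polar: "polar (\<lambda>S. det (\<Sum>i\<in>S. M (f i))) =
      (\<Sum>\<pi> | \<pi> permutes UNIV. det (\<chi> i. M ((f \<circ> \<pi>) i) $ i)) / fact CARD('n)" for f :: "'n \<Rightarrow> 'b"
    by (rule polar_expansion) (simp add: rows det_sum_rows)
  have "det (\<Sum>j\<in>I. c j *\<^sub>R M j) = (\<Sum>f\<in>UNIV \<rightarrow> I. det (\<chi> i. c (f i) *s (M (f i) $ i)))"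
    unfolding rows by (subst det_sum_rows[OF assms]) (simp add: scalar_mult_eq_scaleR)
  also have "\<dots> = (\<Sum>f\<in>UNIV \<rightarrow> I. (\<Prod>i\<in>UNIV. c (f i)) * det (\<chi> i. M (f i) $ i))"
    by (simp add: det_rows_mul)
  also note sum_funcset_polarized
  finally show ?thesis
    by (simp only: polar)
qed

section \<open>Exponential tilting of a finite set\<close>

text \<open>Softmax weights: the uniform distribution on \<open>F\<close>, tilted exponentially in
  direction \<open>x\<close>.\<close>

definition tilt :: "'a::euclidean_space set \<Rightarrow> 'a \<Rightarrow> 'a \<Rightarrow> real" where
  "tilt F x v = exp (v \<bullet> x) / (\<Sum>u\<in>F. exp (u \<bullet> x))"

text \<open>
  The mean and covariance of \<open>F\<close> under the weights \<open>tilt F x\<close> are the gradient and the Hessian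
  of \<open>x \<mapsto> ln (\<Sum>v\<in>F. exp (v \<bullet> x))\<close>.
\<close>

definition tilted_mean :: "'a::euclidean_space set \<Rightarrow> 'a \<Rightarrow> 'a" where
  "tilted_mean F x = (\<Sum>v\<in>F. tilt F x v *\<^sub>R v)"

definition tilted_cov :: "'a::euclidean_space set \<Rightarrow> 'a \<Rightarrow> 'a \<Rightarrow> 'a" where
  "tilted_cov F x h = (\<Sum>v\<in>F. (tilt F x v * ((v - tilted_mean F x) \<bullet> h)) *\<^sub>R v)"

lemma sum_exp_pos:
  assumes "finite F" "F \<noteq> {}"
  shows "(\<Sum>u\<in>F. exp (u \<bullet> x :: real)) > 0"
  using assms by (intro sum_pos) auto

lemma tilt_pos: "finite F \<Longrightarrow> F \<noteq> {} \<Longrightarrow> 0 < tilt F x v"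
  by (simp add: tilt_def sum_exp_pos)

lemma sum_tilt: "finite F \<Longrightarrow> F \<noteq> {} \<Longrightarrow> (\<Sum>v\<in>F. tilt F x v) = 1"
  using sum_exp_pos[of F x] by (simp add: tilt_def sum_divide_distrib[symmetric])

lemma tilted_mean_in_hull:
  assumes "finite F" "F \<noteq> {}"
  shows "tilted_mean F x \<in> convex hull F"
  unfolding tilted_mean_def
  by (rule convex_sum[OF assms(1) convex_convex_hull])
     (use assms in \<open>auto simp: sum_tilt hull_inc intro: less_imp_le tilt_pos\<close>)

lemma has_derivative_ln_sum_exp:
  assumes "finite F" "F \<noteq> {}"
  shows "((\<lambda>x. ln (\<Sum>v\<in>F. exp (v \<bullet> x))) has_derivative (\<lambda>h. tilted_mean F x \<bullet> h)) (at x)"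
proof -
  have "((\<lambda>x. ln (\<Sum>v\<in>F. exp (v \<bullet> x))) has_derivative
      (\<lambda>h. (\<Sum>v\<in>F. (v \<bullet> h) * exp (v \<bullet> x)) * inverse (\<Sum>v\<in>F. exp (v \<bullet> x)))) (at x)"
    using sum_exp_pos[OF assms, of x] by (auto intro!: derivative_eq_intros)
  moreover have "(\<Sum>v\<in>F. (v \<bullet> h) * exp (v \<bullet> x)) * inverse (\<Sum>v\<in>F. exp (v \<bullet> x)) = tilted_mean F x \<bullet> h" for h
    by (simp add: tilted_mean_def tilt_def inner_sum_left sum_distrib_left divide_inverse mult_ac)
  ultimately show ?thesis by simp
qed

lemma has_derivative_tilt:
  assumes "finite F" "F \<noteq> {}"
  shows "((\<lambda>x. tilt F x v) has_derivative
    (\<lambda>h. tilt F x v * ((v - tilted_mean F x) \<bullet> h))) (at x)"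
proof -
  \<comment> \<open>In this form the derivative of the normalising term is already known: it is the
    tilted mean.\<close>
  have eq: "tilt F x v = exp (v \<bullet> x - ln (\<Sum>u\<in>F. exp (u \<bullet> x)))" for x
    using sum_exp_pos[OF assms, of x] by (simp add: tilt_def exp_diff)
  show ?thesis
    unfolding eq
    by (rule has_derivative_eq_rhs, (rule has_derivative_exp has_derivative_diff
        has_derivative_inner_right has_derivative_ident has_derivative_ln_sum_exp[OF assms])+)
       (simp add: inner_diff_left mult.commute)
qed

lemma has_derivative_tilted_mean:
  assumes "finite F" "F \<noteq> {}"
  shows "(tilted_mean F has_derivative tilted_cov F x) (at x)"
  unfolding tilted_mean_def[abs_def] tilted_cov_def
  by (rule has_derivative_eq_rhs, rule has_derivative_sum,
      rule has_derivative_scaleR_left[OF has_derivative_tilt[OF assms]])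
     (simp add: tilted_mean_def)

text \<open>\<open>tilted_cov\<close> centres only one of its two factors. Centring the other as
  well changes nothing, since the weighted deviations from the mean sum to zero; the result is the
  variance of \<open>v \<bullet> h\<close>.\<close>

lemma tilted_cov_inner:
  assumes "finite F" "F \<noteq> {}"
  shows "tilted_cov F x h \<bullet> h = (\<Sum>v\<in>F. tilt F x v * ((v - tilted_mean F x) \<bullet> h)\<^sup>2)"
proof -
  let ?m = "tilted_mean F x \<bullet> h"
  have m: "?m = (\<Sum>v\<in>F. tilt F x v * (v \<bullet> h))"
    by (simp add: tilted_mean_def inner_sum_left)
  have "(\<Sum>v\<in>F. tilt F x v * ((v \<bullet> h - ?m) * ?m)) =
      ((\<Sum>v\<in>F. tilt F x v * (v \<bullet> h)) - (\<Sum>v\<in>F. tilt F x v) * ?m) * ?m"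
    by (simp add: sum_distrib_right sum_subtractf left_diff_distrib right_diff_distrib mult.assoc)
  also have "\<dots> = 0"
    using m by (simp add: sum_tilt[OF assms])
  finally have "(\<Sum>v\<in>F. tilt F x v * ((v \<bullet> h - ?m) * ?m)) = 0" .
  moreover have "tilted_cov F x h \<bullet> h = (\<Sum>v\<in>F. tilt F x v * ((v \<bullet> h - ?m) * (v \<bullet> h)))"
    by (simp add: tilted_cov_def inner_sum_left inner_diff_left mult.assoc)
  ultimately have "tilted_cov F x h \<bullet> h =
      (\<Sum>v\<in>F. tilt F x v * ((v \<bullet> h - ?m) * (v \<bullet> h))) - (\<Sum>v\<in>F. tilt F x v * ((v \<bullet> h - ?m) * ?m))"
    by simp
  then show ?thesis
    by (simp add: sum_subtractf[symmetric] right_diff_distrib[symmetric] inner_diff_left power2_eq_square)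
qed

text \<open>All weights are positive, so the variance of \<open>v \<bullet> h\<close> vanishes only
  if \<open>F\<close> lies in a hyperplane orthogonal to \<open>h\<close>, which the interior point
  of the hull excludes.\<close>

lemma tilted_cov_pos:
  assumes "finite F" "interior (convex hull F) \<noteq> {}" "h \<noteq> 0"
  shows "0 < tilted_cov F x h \<bullet> h"
proof -
  have F: "F \<noteq> {}" using assms(2) by auto
  obtain v where v: "v \<in> F" "(v - tilted_mean F x) \<bullet> h \<noteq> 0"
  proof (rule ccontr)
    assume "\<not> thesis"
    then have "F \<subseteq> {v. h \<bullet> v = h \<bullet> tilted_mean F x}"
      using that by (auto simp: inner_diff_left inner_commute[of h])
    then have "convex hull F \<subseteq> {v. h \<bullet> v = h \<bullet> tilted_mean F x}"
      by (rule hull_minimal) (rule convex_hyperplane)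
    then have "interior (convex hull F) \<subseteq> interior {v. h \<bullet> v = h \<bullet> tilted_mean F x}"
      by (rule interior_mono)
    with assms show False by simp
  qed
  show ?thesis
    unfolding tilted_cov_inner[OF assms(1) F]
    using assms(1) F v
    by (intro sum_pos2[of F v]) (auto intro!: mult_pos_pos tilt_pos mult_nonneg_nonneg less_imp_le[OF tilt_pos])
qed

text \<open>Each exponential is at most the whole sum, which settles the points of \<open>F\<close>;
  a halfspace containing \<open>F\<close> contains its hull. The bound yields coercivity
  below.\<close>

lemma support_le_ln_sum_exp:
  assumes "finite F" "p \<in> convex hull F"
  shows "p \<bullet> x \<le> ln (\<Sum>v\<in>F. exp (v \<bullet> x))"
proof -
  have F: "F \<noteq> {}" using assms(2) by auto
  have "F \<subseteq> {p. x \<bullet> p \<le> ln (\<Sum>v\<in>F. exp (v \<bullet> x))}"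
  proof
    fix v assume "v \<in> F"
    then have "exp (v \<bullet> x) \<le> (\<Sum>v\<in>F. exp (v \<bullet> x))"
      using assms(1) by (intro member_le_sum) auto
    then show "v \<in> {p. x \<bullet> p \<le> ln (\<Sum>v\<in>F. exp (v \<bullet> x))}"
      using sum_exp_pos[OF assms(1) F, of x] by (simp add: ln_ge_iff inner_commute)
  qed
  then have "convex hull F \<subseteq> {p. x \<bullet> p \<le> ln (\<Sum>v\<in>F. exp (v \<bullet> x))}"
    by (rule hull_minimal) (rule convex_halfspace_le)
  with assms(2) show ?thesis by (auto simp: inner_commute)
qed

text \<open>\<open>f\<close> is not assumed self-adjoint, so the argument is a homotopy: every map
  on the segment from the identity to \<open>f\<close> has a positive quadratic form, hence is
  invertible, and the determinant keeps its sign.\<close>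

lemma det_pos_of_positive:
  fixes f :: "real^'n::finite \<Rightarrow> real^'n"
  assumes "linear f" and pos: "\<And>h. h \<noteq> 0 \<Longrightarrow> 0 < f h \<bullet> h"
  shows "0 < det (matrix f)"
proof (rule ccontr)
  assume neg: "\<not> 0 < det (matrix f)"
  define M where "M t = (1 - t) *\<^sub>R mat 1 + t *\<^sub>R matrix f" for t :: real
  have M: "M t *v h = (1 - t) *\<^sub>R h + t *\<^sub>R f h" for t h
    using matrix_works[OF assms(1)[unfolded linear_matrix_vector_mul_eq[symmetric]]]
    by (simp add: M_def matrix_vector_mult_add_rdistrib scaleR_matrix_vector_assoc[symmetric] assms(1))
  have "continuous_on {0..1} (\<lambda>t. det (M t))"
    unfolding det_def M_def by (intro continuous_intros)
  moreover have "det (M 0) = 1" "det (M 1) = det (matrix f)"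
    by (simp_all add: M_def)
  ultimately obtain t where t: "0 \<le> t" "t \<le> 1" "det (M t) = 0"
    using IVT2'[of "\<lambda>t. det (M t)" 1 0 0] neg by auto
  then obtain h where h: "h \<noteq> 0" "M t *v h = 0"
    by (metis invertible_det_nz invertible_left_inverse matrix_left_invertible_ker)
  then have "(1 - t) * (h \<bullet> h) + t * (f h \<bullet> h) = 0"
    unfolding M by (metis inner_add_left inner_scaleR_left inner_zero_left)
  moreover have "(1 - t) * (h \<bullet> h) + t * (f h \<bullet> h) > 0"
  proof (cases "t = 0")
    case False
    then show ?thesis
      using t pos[OF h(1)] by (intro add_nonneg_pos mult_pos_pos mult_nonneg_nonneg) auto
  qed (use h in simp)
  ultimately show False by simp
qed

section \<open>The volume of a sum of polytopes\<close>

lemma mem_set_sum: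
  "finite I \<Longrightarrow> x \<in> (\<Sum>i\<in>I. K i) \<longleftrightarrow> (\<exists>s. x = (\<Sum>i\<in>I. s i) \<and> (\<forall>i\<in>I. s i \<in> K i))"
  by (auto simp: set_sum_alt)

lemma compact_set_plus: "compact A \<Longrightarrow> compact B \<Longrightarrow> compact (A + B)"
  for A B :: "'a::real_normed_vector set"
proof -
  assume "compact A" "compact B"
  moreover have "A + B = {x + y |x y. x \<in> A \<and> y \<in> B}" by (auto simp: set_plus_def)
  ultimately show ?thesis using compact_sums[of A B] by simp
qed

lemma compact_set_sum:
  fixes K :: "'b \<Rightarrow> 'a::real_normed_vector set"
  shows "(\<And>i. i \<in> I \<Longrightarrow> compact (K i)) \<Longrightarrow> compact (\<Sum>i\<in>I. K i)"
  by (induction I rule: infinite_finite_induct) (auto simp: compact_set_plus set_zero)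

text \<open>The function \<open>\<psi>\<close>, a combination of log-sum-exp functions minus
  \<open>y \<bullet> x\<close>, is coercive because a ball around \<open>y\<close> lies in the sum.
  At a minimiser its gradient vanishes, which says that \<open>y\<close> is the value of the
  gradient map there.\<close>

lemma interior_set_sum_subset_tilted_mean:
  fixes F :: "'b \<Rightarrow> 'a::euclidean_space set"
  assumes I: "finite I" and c: "\<And>i. i \<in> I \<Longrightarrow> 0 \<le> c i"
    and F: "\<And>i. i \<in> I \<Longrightarrow> finite (F i)" "\<And>i. i \<in> I \<Longrightarrow> F i \<noteq> {}"
    and y: "y \<in> interior (\<Sum>i\<in>I. (*\<^sub>R) (c i) ` (convex hull F i))"
  shows "y \<in> range (\<lambda>x. \<Sum>i\<in>I. c i *\<^sub>R tilted_mean (F i) x)"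
proof -
  define \<psi> where "\<psi> x = (\<Sum>i\<in>I. c i * ln (\<Sum>v\<in>F i. exp (v \<bullet> x))) - y \<bullet> x" for x
  obtain r where r: "0 < r" "cball y r \<subseteq> (\<Sum>i\<in>I. (*\<^sub>R) (c i) ` (convex hull F i))"
    using y by (auto simp: mem_interior_cball)
  have coercive: "r * norm x \<le> \<psi> x" for x
  proof -
    \<comment> \<open>The point of the ball furthest in direction \<open>x\<close> has inner product
      \<open>y \<bullet> x + r * norm x\<close> with \<open>x\<close>.\<close>
    have "y + r *\<^sub>R sgn x \<in> cball y r"
      using r by (simp add: dist_norm norm_sgn)
    then have "y + r *\<^sub>R sgn x \<in> (\<Sum>i\<in>I. (*\<^sub>R) (c i) ` (convex hull F i))"
      using r(2) by blast
    then obtain s where s: "y + r *\<^sub>R sgn x = (\<Sum>i\<in>I. s i)"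
        "\<And>i. i \<in> I \<Longrightarrow> s i \<in> (*\<^sub>R) (c i) ` (convex hull F i)"
      unfolding mem_set_sum[OF I] by blast
    have "s i \<bullet> x \<le> c i * ln (\<Sum>v\<in>F i. exp (v \<bullet> x))" if "i \<in> I" for i
      using s(2)[OF that] support_le_ln_sum_exp[OF F(1)[OF that]] c[OF that]
      by (auto intro!: mult_left_mono)
    then have "(\<Sum>i\<in>I. s i) \<bullet> x \<le> (\<Sum>i\<in>I. c i * ln (\<Sum>v\<in>F i. exp (v \<bullet> x)))"
      unfolding inner_sum_left by (rule sum_mono)
    moreover have "sgn x \<bullet> x = norm x"
      by (cases "x = 0") (simp_all add: sgn_div_norm dot_square_norm power2_eq_square)
    ultimately show ?thesis
      by (simp add: s(1)[symmetric] \<psi>_def inner_add_left)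
  qed
  have der: "(\<psi> has_derivative (\<lambda>h. (\<Sum>i\<in>I. c i * (tilted_mean (F i) x \<bullet> h)) - y \<bullet> h)) (at x)" for x
    unfolding \<psi>_def
    by (intro has_derivative_diff has_derivative_sum has_derivative_mult_right
        has_derivative_ln_sum_exp has_derivative_inner_right has_derivative_ident F)
  \<comment> \<open>Beyond this radius coercivity gives values above \<open>\<psi> 0\<close>, so a
    minimiser on the ball is global.\<close>
  define R where "R = \<psi> 0 / r"
  have "0 \<le> R" using coercive[of 0] r by (simp add: R_def)
  have "continuous_on (cball 0 R) \<psi>"
    by (rule has_derivative_continuous_on) (rule has_derivative_at_withinI[OF der])
  then obtain x where x: "\<forall>z\<in>cball 0 R. \<psi> x \<le> \<psi> z"
    using continuous_attains_inf[of "cball (0::'a) R" \<psi>] \<open>0 \<le> R\<close> by auto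
  have "\<psi> x \<le> \<psi> z" for z
  proof (cases "z \<in> cball 0 R")
    case False
    then have "\<psi> 0 < r * norm z" using r by (simp add: R_def field_simps)
    moreover have "\<psi> x \<le> \<psi> 0" using x \<open>0 \<le> R\<close> by auto
    ultimately show ?thesis using coercive[of z] by simp
  qed (use x in auto)
  then have "(\<lambda>h. (\<Sum>i\<in>I. c i * (tilted_mean (F i) x \<bullet> h)) - y \<bullet> h) = (\<lambda>h. 0)"
    by (intro has_derivative_local_min[OF der]) (rule always_eventually, simp)
  then have "((\<Sum>i\<in>I. c i *\<^sub>R tilted_mean (F i) x) - y) \<bullet> h = 0" for h
    by (simp add: fun_eq_iff inner_diff_left inner_sum_left)
  then have "(\<Sum>i\<in>I. c i *\<^sub>R tilted_mean (F i) x) - y = 0"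
    using inner_eq_zero_iff by blast
  then show ?thesis by (intro range_eqI[of _ _ x]) simp
qed

text \<open>If \<open>g\<close> took equal values at \<open>x\<close> and \<open>y\<close>, its
  component along \<open>h = y - x\<close> would agree at both ends of the segment between them, yet
  it increases strictly along it.\<close>

lemma inj_of_positive_derivative:
  fixes g :: "'a::euclidean_space \<Rightarrow> 'a"
  assumes der: "\<And>x. (g has_derivative g' x) (at x)"
    and pos: "\<And>x h. h \<noteq> 0 \<Longrightarrow> 0 < g' x h \<bullet> h"
  shows "inj g"
proof (rule injI, rule ccontr)
  fix x y assume xy: "g x = g y" "x \<noteq> y"
  define h where "h = y - x"
  have d: "((\<lambda>t. g (x + t *\<^sub>R h) \<bullet> h) has_real_derivative g' (x + t *\<^sub>R h) h \<bullet> h) (at t)" for t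
  proof -
    have "((\<lambda>t. x + t *\<^sub>R h) has_derivative (\<lambda>t. t *\<^sub>R h)) (at t)"
      by (auto intro!: derivative_eq_intros)
    from has_derivative_inner_left[OF has_derivative_compose[OF this der], of h]
    have "((\<lambda>t. g (x + t *\<^sub>R h) \<bullet> h) has_derivative (\<lambda>s. g' (x + t *\<^sub>R h) (s *\<^sub>R h) \<bullet> h)) (at t)" .
    moreover have "(\<lambda>s. g' (x + t *\<^sub>R h) (s *\<^sub>R h) \<bullet> h) = (*) (g' (x + t *\<^sub>R h) h \<bullet> h)"
      by (rule ext) (simp add: linear_cmul[OF has_derivative_linear[OF der]] mult.commute)
    ultimately show ?thesis
      by (simp add: has_field_derivative_def)
  qed
  have "g (x + 0 *\<^sub>R h) \<bullet> h < g (x + 1 *\<^sub>R h) \<bullet> h"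
    by (rule DERIV_pos_imp_increasing[of 0 1]) (use d pos[of h] xy in \<open>auto simp: h_def\<close>)
  with xy show False by (simp add: h_def)
qed

lemma det_zero_matrix: "det (0 :: real^'n::finite^'n) = 0"
  by (rule det_zero_row(1)) (simp add: row_def vec_eq_iff)

text \<open>Change of variables for the gradient map \<open>g\<close>: it is injective, its Jacobian
  determinant is positive, and its image is the Minkowski sum up to a null set.\<close>

proposition volume_sum_polytopes_has_integral:
  fixes F :: "'b \<Rightarrow> (real^'n::{finite,wellorder}) set"
  assumes I: "finite I" and c: "\<And>i. i \<in> I \<Longrightarrow> 0 \<le> c i"
    and F: "\<And>i. i \<in> I \<Longrightarrow> finite (F i)" "\<And>i. i \<in> I \<Longrightarrow> interior (convex hull F i) \<noteq> {}"
  shows "((\<lambda>x. det (\<Sum>i\<in>I. c i *\<^sub>R matrix (tilted_cov (F i) x))) has_integral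
    measure lebesgue (\<Sum>i\<in>I. (*\<^sub>R) (c i) ` (convex hull F i))) UNIV"
proof -
  have F0: "F i \<noteq> {}" if "i \<in> I" for i using F(2)[OF that] by auto
  let ?K = "\<Sum>i\<in>I. (*\<^sub>R) (c i) ` (convex hull F i)"
  show ?thesis
  \<comment> \<open>With all coefficients zero, \<open>g\<close> is constant and both sides vanish;
    one positive coefficient is what makes the derivative positive.\<close>
  proof (cases "\<forall>i\<in>I. c i = 0")
    case True
    then have "(*\<^sub>R) (c i) ` (convex hull F i) = 0" if "i \<in> I" for i
      using that F0[OF that] by (simp add: set_zero image_constant_conv)
    then have "?K = 0" by (intro sum.neutral ballI)
    then have "?K = {0}" by simp
    then show ?thesis using True by (simp add: det_zero_matrix)
  next
    case False
    then obtain k where k: "k \<in> I" "0 < c k" using c by force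
    define g where "g x = (\<Sum>i\<in>I. c i *\<^sub>R tilted_mean (F i) x)" for x
    define g' where "g' x h = (\<Sum>i\<in>I. c i *\<^sub>R tilted_cov (F i) x h)" for x h
    have der: "(g has_derivative g' x) (at x)" for x
      unfolding g_def g'_def
      by (intro has_derivative_sum has_derivative_scaleR_right has_derivative_tilted_mean F F0)
    have pos: "0 < g' x h \<bullet> h" if "h \<noteq> 0" for x h
      unfolding g'_def inner_sum_left inner_scaleR_left
    proof (rule sum_pos2[OF I k(1)])
      show "0 < c k * (tilted_cov (F k) x h \<bullet> h)"
        using k that by (intro mult_pos_pos tilted_cov_pos F)
      show "0 \<le> c i * (tilted_cov (F i) x h \<bullet> h)" if "i \<in> I" for i
        using that \<open>h \<noteq> 0\<close> by (intro mult_nonneg_nonneg c less_imp_le[OF tilted_cov_pos] F)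
    qed
    have mat: "matrix (g' x) = (\<Sum>i\<in>I. c i *\<^sub>R matrix (tilted_cov (F i) x))" for x
      by (simp add: matrix_def g'_def vec_eq_iff)
    have det: "\<bar>det (matrix (g' x))\<bar> = det (\<Sum>i\<in>I. c i *\<^sub>R matrix (tilted_cov (F i) x))" for x
      using det_pos_of_positive[OF has_derivative_linear[OF der] pos, of x] by (simp add: mat)
    have K: "compact ?K" "convex ?K"
      using F by (auto intro!: compact_set_sum convex_set_sum compact_scaling convex_scaling
          finite_imp_compact_convex_hull)
    have sub: "interior ?K \<subseteq> range g" "range g \<subseteq> ?K"
    proof -
      show "interior ?K \<subseteq> range g"
        using interior_set_sum_subset_tilted_mean[OF I c F(1) F0] by (auto simp: g_def)
      show "range g \<subseteq> ?K"
      proof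
        fix y assume "y \<in> range g"
        then obtain x where "y = (\<Sum>i\<in>I. c i *\<^sub>R tilted_mean (F i) x)" by (auto simp: g_def)
        moreover have "\<forall>i\<in>I. c i *\<^sub>R tilted_mean (F i) x \<in> (*\<^sub>R) (c i) ` (convex hull F i)"
          by (intro ballI imageI[where f = "(*\<^sub>R) (c _)"] tilted_mean_in_hull F(1) F0)
        ultimately show "y \<in> ?K"
          unfolding mem_set_sum[OF I] by (intro exI conjI)
      qed
    qed
    have "negligible (frontier ?K)" by (rule negligible_convex_frontier[OF K(2)])
    \<comment> \<open>The image lies between the interior and the closed sum, and the frontier of a
      convex set is a null set.\<close>
    moreover have "sym_diff ?K (range g) \<subseteq> frontier ?K"
      unfolding frontier_def closure_closed[OF compact_imp_closed[OF K(1)]] using sub by blast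
    ultimately have "negligible (sym_diff ?K (range g))" by (rule negligible_subset)
    then have "range g \<in> lmeasurable \<and> measure lebesgue (range g) = measure lebesgue ?K"
      using lmeasurable_negligible_symdiff[OF lmeasurable_compact[OF K(1)]]
        measure_negligible_symdiff[OF lmeasurable_compact[OF K(1)]] by blast
    moreover have "inj g" using der pos by (rule inj_of_positive_derivative)
    ultimately have "((\<lambda>x. \<bar>det (matrix (g' x))\<bar>) has_integral measure lebesgue ?K) UNIV"
      using has_measure_differentiable_image[of UNIV g g' "measure lebesgue ?K"] der by simp
    then show ?thesis by (simp only: det)
  qed
qed

text \<open>The candidate for the mixed volume. It makes sense for arbitrary tuples, including the
  degenerate limits met later.\<close>

definition polar_volume :: "('n::finite \<Rightarrow> (real^'n) set) \<Rightarrow> real" where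
  "polar_volume K = polar (\<lambda>S. measure lebesgue (\<Sum>i\<in>S. K i))"

text \<open>The determinant expansion holds at every point, and integrating it turns the left side
  into the volume of the sum and each mixed discriminant into a polarized volume.\<close>

lemma volume_sum_polytopes_wellorder:
  fixes F :: "'b \<Rightarrow> (real^'n::{finite,wellorder}) set"
  assumes I: "finite I" and c: "\<And>i. i \<in> I \<Longrightarrow> 0 \<le> c i"
    and F: "\<And>i. i \<in> I \<Longrightarrow> finite (F i)" "\<And>i. i \<in> I \<Longrightarrow> interior (convex hull F i) \<noteq> {}"
  shows "measure lebesgue (\<Sum>i\<in>I. (*\<^sub>R) (c i) ` (convex hull F i)) =
    (\<Sum>f\<in>UNIV \<rightarrow> I. (\<Prod>i\<in>UNIV. c (f i)) * polar_volume (\<lambda>i. convex hull F (f i)))"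
proof -
  let ?H = "\<lambda>i x. matrix (tilted_cov (F i) x)"
  have fin: "finite ((UNIV :: 'n set) \<rightarrow> I)"
    using finite_PiE[of "UNIV :: 'n set" "\<lambda>_. I"] I by (simp add: PiE_UNIV_domain)
  \<comment> \<open>Polarization is a finite linear combination over \<open>S\<close>, and for each
    \<open>S\<close> the integral formula with unit coefficients applies.\<close>
  have "((\<lambda>x. polar (\<lambda>S. det (\<Sum>i\<in>S. ?H (f i) x))) has_integral
      polar_volume (\<lambda>i. convex hull F (f i))) UNIV" if "f \<in> (UNIV :: 'n set) \<rightarrow> I" for f
    unfolding polar_def polar_volume_def
  proof (intro has_integral_divide has_integral_sum has_integral_mult_right finite)
    fix S :: "'n set"
    show "((\<lambda>x. det (\<Sum>i\<in>S. ?H (f i) x)) has_integral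
        measure lebesgue (\<Sum>i\<in>S. convex hull F (f i))) UNIV"
      using volume_sum_polytopes_has_integral[of S "\<lambda>_. 1" "F \<circ> f"] F that by (simp add: Pi_iff)
  qed
  then have "((\<lambda>x. \<Sum>f\<in>(UNIV :: 'n set) \<rightarrow> I. (\<Prod>i\<in>UNIV. c (f i)) * polar (\<lambda>S. det (\<Sum>i\<in>S. ?H (f i) x))) has_integral
      (\<Sum>f\<in>(UNIV :: 'n set) \<rightarrow> I. (\<Prod>i\<in>UNIV. c (f i)) * polar_volume (\<lambda>i. convex hull F (f i)))) UNIV"
    by (intro has_integral_sum fin has_integral_mult_right)
  then have "((\<lambda>x. det (\<Sum>i\<in>I. c i *\<^sub>R ?H i x)) has_integral
      (\<Sum>f\<in>(UNIV :: 'n set) \<rightarrow> I. (\<Prod>i\<in>UNIV. c (f i)) * polar_volume (\<lambda>i. convex hull F (f i)))) UNIV"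
    unfolding det_linear_combination[OF I] .
  with volume_sum_polytopes_has_integral[OF I c F] show ?thesis
    by (rule has_integral_unique)
qed

section \<open>Transfer to arbitrary finite coordinate types\<close>

text \<open>
  The library proves change of variables only for coordinate types that are well-ordered;
  renaming the coordinates along this copy removes the restriction.
\<close>

typedef 'a ordered_copy = "UNIV :: 'a set" by simp

lemma bij_Rep_ordered_copy: "bij Rep_ordered_copy"
  by (metis Abs_ordered_copy_inverse Rep_ordered_copy_inverse UNIV_I bijI')

instantiation ordered_copy :: (finite) "{finite,wellorder}"
begin

definition ordered_copy_index :: "'a ordered_copy \<Rightarrow> nat" where
  "ordered_copy_index = (SOME f. inj f)"

definition less_eq_ordered_copy :: "'a ordered_copy \<Rightarrow> 'a ordered_copy \<Rightarrow> bool" where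
  "less_eq_ordered_copy x y \<longleftrightarrow> ordered_copy_index x \<le> ordered_copy_index y"

definition less_ordered_copy :: "'a ordered_copy \<Rightarrow> 'a ordered_copy \<Rightarrow> bool" where
  "less_ordered_copy x y \<longleftrightarrow> ordered_copy_index x < ordered_copy_index y"

instance
proof
  show fin: "finite (UNIV :: 'a ordered_copy set)"
  proof -
    have "(UNIV :: 'a ordered_copy set) = range Abs_ordered_copy"
      by (metis Rep_ordered_copy_inverse surj_def)
    then show ?thesis using finite_imageI[OF finite[of "UNIV :: 'a set"]] by metis
  qed
  then have "\<exists>f :: 'a ordered_copy \<Rightarrow> nat. inj f"
    using finite_imp_inj_to_nat_seg[OF fin] by auto
  then have inj: "inj (ordered_copy_index :: 'a ordered_copy \<Rightarrow> nat)"
    unfolding ordered_copy_index_def by (rule someI_ex)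
  fix x y z :: "'a ordered_copy"
  show "x < y \<longleftrightarrow> x \<le> y \<and> \<not> y \<le> x" "x \<le> x" "x \<le> y \<or> y \<le> x"
    by (auto simp: less_eq_ordered_copy_def less_ordered_copy_def)
  show "x \<le> y \<Longrightarrow> y \<le> z \<Longrightarrow> x \<le> z"
    by (simp add: less_eq_ordered_copy_def)
  show "x \<le> y \<Longrightarrow> y \<le> x \<Longrightarrow> x = y"
    using inj by (simp add: less_eq_ordered_copy_def inj_eq)
  fix P :: "'a ordered_copy \<Rightarrow> bool"
  assume "\<And>x. (\<And>y. y < x \<Longrightarrow> P y) \<Longrightarrow> P x"
  then show "P x"
    unfolding less_ordered_copy_def by (rule measure_induct_rule)
qed

end

lemma prod_Basis_cart: "(\<Prod>b\<in>(Basis :: (real^'n) set). f b) = (\<Prod>i\<in>UNIV. f (axis i 1))"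
proof -
  have B: "(Basis :: (real^'n) set) = range (\<lambda>i. axis i 1)"
    by (auto simp: Basis_vec_def)
  have inj: "inj (\<lambda>i. axis i (1::real) :: real^'n)"
    by (auto simp: inj_def axis_eq_axis)
  show ?thesis unfolding B by (subst prod.reindex[OF inj]) simp
qed

text \<open>Renaming coordinates carries boxes to boxes with the same side lengths, and Lebesgue
  measure is determined by its values on boxes.\<close>

lemma measure_coordinate_bijection:
  fixes h :: "'m::finite \<Rightarrow> 'n::finite" and K :: "(real^'n) set"
  assumes "bij h" "compact K"
  shows "measure lebesgue ((\<lambda>x. \<chi> i. x $ h i) ` K) = measure lebesgue K"
proof -
  let ?T = "\<lambda>x::real^'n. (\<chi> i. x $ h i) :: real^'m"
  let ?T' = "\<lambda>x::real^'m. (\<chi> i. x $ inv h i) :: real^'n"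
  have h: "h (inv h i) = i" "inv h (h j) = j" for i j
    using assms(1) by (simp_all add: bij_is_surj surj_f_inv_f bij_is_inj)
  have cont: "continuous_on A ?T" for A
    by (intro continuous_intros)
  have T: "?T \<in> borel_measurable borel"
    by (rule borel_measurable_continuous_onI[OF cont])
  have inj: "inj ?T"
    by (rule inj_on_inverseI[of _ ?T']) (simp add: h)
  have "lborel = distr lborel borel ?T"
  proof (rule lborel_eqI)
    fix l u :: "real^'m" assume lu: "\<And>b. b \<in> Basis \<Longrightarrow> l \<bullet> b \<le> u \<bullet> b"
    then have le: "l $ i \<le> u $ i" for i
      by (metis axis_in_Basis_iff Basis_real_def cart_eq_inner_axis singletonI)
    have "?T -` box l u = box (?T' l) (?T' u)"
      by (auto simp: mem_box_cart) (metis h)+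
    then have "emeasure (distr lborel borel ?T) (box l u) = emeasure lborel (box (?T' l) (?T' u))"
      using T by (subst emeasure_distr) auto
    also have "\<dots> = (\<Prod>b\<in>Basis. (?T' u - ?T' l) \<bullet> b)"
      using le by (intro emeasure_lborel_box) (auto simp: Basis_vec_def inner_axis)
    also have "\<dots> = (\<Prod>i\<in>UNIV. u $ inv h i - l $ inv h i)"
      unfolding prod_Basis_cart by (simp add: inner_axis)
    also have "(\<Prod>i\<in>UNIV. u $ inv h i - l $ inv h i) = (\<Prod>i\<in>UNIV. u $ i - l $ i)"
      by (rule prod.reindex_bij_betw[OF bij_imp_bij_inv[OF assms(1)]])
    also have "\<dots> = (\<Prod>b\<in>Basis. (u - l) \<bullet> b)"
      unfolding prod_Basis_cart by (simp add: inner_axis)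
    finally show "emeasure (distr lborel borel ?T) (box l u) = (\<Prod>b\<in>Basis. (u - l) \<bullet> b)" .
  qed simp
  then have "measure lborel (?T ` K) = measure (distr lborel borel ?T) (?T ` K)"
    by simp
  also have "\<dots> = measure lborel K"
    using T compact_imp_closed[OF compact_continuous_image[OF cont assms(2)]]
    by (subst measure_distr) (auto simp: inj_vimage_image_eq[OF inj])
  finally show ?thesis
    using compact_imp_closed[OF compact_continuous_image[OF cont assms(2)]] compact_imp_closed[OF assms(2)]
    by simp
qed

lemma linear_image_set_sum:
  assumes "linear T"
  shows "T ` (\<Sum>i\<in>I. K i) = (\<Sum>i\<in>I. T ` K i)"
proof -
  have "T ` A + T ` B = T ` (A + B)" for A B
  proof
    show "T ` A + T ` B \<subseteq> T ` (A + B)"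
      by (auto elim!: set_plus_elim simp: linear_add[OF assms, symmetric])
    show "T ` (A + B) \<subseteq> T ` A + T ` B"
      by (auto elim!: set_plus_elim intro!: set_plus_intro simp: linear_add[OF assms])
  qed
  then show ?thesis
    using sum_set_linear[of "(`) T" K I] linear_0[OF assms] by (simp add: o_def)
qed

text \<open>The renaming \<open>T\<close> onto the ordered copy is linear and preserves volume, so
  it preserves hulls, Minkowski sums and every volume in the formula.\<close>

proposition volume_sum_polytopes:
  fixes F :: "'b \<Rightarrow> (real^'n::finite) set"
  assumes I: "finite I" and c: "\<And>i. i \<in> I \<Longrightarrow> 0 \<le> c i"
    and F: "\<And>i. i \<in> I \<Longrightarrow> finite (F i)" "\<And>i. i \<in> I \<Longrightarrow> interior (convex hull F i) \<noteq> {}"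
  shows "measure lebesgue (\<Sum>i\<in>I. (*\<^sub>R) (c i) ` (convex hull F i)) =
    (\<Sum>f\<in>UNIV \<rightarrow> I. (\<Prod>i\<in>UNIV. c (f i)) * polar_volume (\<lambda>i. convex hull F (f i)))"
proof -
  define h where "h = (Rep_ordered_copy :: 'n ordered_copy \<Rightarrow> 'n)"
  have h: "bij h" by (simp add: h_def bij_Rep_ordered_copy)
  define T where "T x = (\<chi> i. x $ h i)" for x :: "real^'n"
  have T: "linear T" by (rule linearI) (simp_all add: T_def vec_eq_iff)
  have surj: "surj T"
    by (rule surjI[of _ "\<lambda>y. \<chi> i. y $ inv h i"]) (simp add: T_def bij_is_inj[OF h])
  have hull: "T ` (convex hull X) = convex hull (T ` X)" for X
    by (rule convex_hull_linear_image[OF T])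
  have scale: "T ` (*\<^sub>R) a ` X = (*\<^sub>R) a ` T ` X" for a X
    by (simp add: image_image linear_cmul[OF T])
  have meas: "measure lebesgue (\<Sum>i\<in>J. T ` K i) = measure lebesgue (\<Sum>i\<in>J. K i)"
    if "\<And>i. i \<in> J \<Longrightarrow> compact (K i)" for J :: "'c set" and K
    unfolding linear_image_set_sum[OF T, symmetric] T_def
    by (rule measure_coordinate_bijection[OF h compact_set_sum[OF that]])
  have "measure lebesgue (\<Sum>i\<in>I. (*\<^sub>R) (c i) ` (convex hull F i)) =
      measure lebesgue (\<Sum>i\<in>I. (*\<^sub>R) (c i) ` (convex hull (T ` F i)))"
    using F(1) unfolding hull[symmetric] scale[symmetric]
    by (intro meas[symmetric] compact_scaling finite_imp_compact_convex_hull)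
  also have "\<dots> = (\<Sum>f\<in>UNIV \<rightarrow> I. (\<Prod>i\<in>UNIV. c (f i)) * polar_volume (\<lambda>i. convex hull (T ` F (f i))))"
  proof (rule volume_sum_polytopes_wellorder[OF I c])
    show "interior (convex hull (T ` F i)) \<noteq> {}" if "i \<in> I" for i
    proof -
      have "T ` interior (convex hull F i) \<subseteq> interior (T ` (convex hull F i))"
        by (intro interior_maximal image_mono interior_subset open_surjective_linear_image T surj) simp
      then show ?thesis using F(2)[OF that] by (auto simp: hull)
    qed
  qed (use F in auto)
  also have "\<dots> = (\<Sum>f\<in>UNIV \<rightarrow> I. (\<Prod>i\<in>UNIV. c (f i)) * polar_volume (\<lambda>i. convex hull F (f i)))"
  \<comment> \<open>Multi-indices over the two coordinate types correspond by composition with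
    \<open>h\<close>.\<close>
  proof (rule sum.reindex_bij_witness[of _ "\<lambda>f. f \<circ> h" "\<lambda>f. f \<circ> inv h"])
    fix f assume f: "f \<in> (UNIV :: 'n ordered_copy set) \<rightarrow> I"
    show "f \<circ> inv h \<circ> h = f" using h by (simp add: o_assoc[symmetric] bij_is_inj)
    have "polar (\<lambda>S. measure lebesgue (\<Sum>i\<in>S. convex hull F ((f \<circ> inv h) i))) =
        polar (\<lambda>S. measure lebesgue (\<Sum>i\<in>h ` S. convex hull F ((f \<circ> inv h) i)))"
      by (rule polar_reindex[OF h, symmetric])
    also have "\<dots> = polar (\<lambda>S. measure lebesgue (\<Sum>i\<in>S. convex hull F (f i)))"
      by (subst sum.reindex) (auto simp: bij_is_inj[OF h] intro: inj_on_subset[OF bij_is_inj[OF h]])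
    also have "\<dots> = polar (\<lambda>S. measure lebesgue (\<Sum>i\<in>S. T ` (convex hull F (f i))))"
      using F(1) f by (subst meas) (auto intro!: finite_imp_compact_convex_hull)
    finally have "polar_volume (\<lambda>i. convex hull F ((f \<circ> inv h) i)) = polar_volume (\<lambda>i. convex hull (T ` F (f i)))"
      by (simp add: polar_volume_def hull)
    moreover have "(\<Prod>i\<in>UNIV. c ((f \<circ> inv h) i)) = (\<Prod>i\<in>UNIV. c (f i))"
      using prod.reindex_bij_betw[OF bij_imp_bij_inv[OF h], of "\<lambda>i. c (f i)"] by simp
    ultimately show "(\<Prod>i\<in>UNIV. c ((f \<circ> inv h) i)) * polar_volume (\<lambda>i. convex hull F ((f \<circ> inv h) i)) =
        (\<Prod>i\<in>UNIV. c (f i)) * polar_volume (\<lambda>i. convex hull (T ` F (f i)))"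
      by simp
  qed (auto simp: o_assoc[symmetric] bij_is_surj[OF h, unfolded surj_iff])
  finally show ?thesis .
qed

section \<open>Existence and uniqueness of the mixed volume\<close>

text \<open>Shrinking \<open>K\<close> slightly towards an interior point gives a compact subset of
  the interior. Finitely many boxes inside the interior cover it, and their vertices form
  \<open>F\<close>.\<close>

lemma convex_body_polytope_approx:
  fixes K :: "'a::euclidean_space set"
  assumes K: "convex_body K" and \<epsilon>: "0 < \<epsilon>"
  obtains F a where "finite F" "interior (convex hull F) \<noteq> {}" "convex hull F \<subseteq> K"
    "K \<subseteq> (\<lambda>x. (1 + \<epsilon>) *\<^sub>R x + a) ` (convex hull F)"
proof -
  have cK: "compact K" "convex K" and "interior K \<noteq> {}"
    using K by (auto simp: convex_body_def)
  then obtain p where p: "p \<in> interior K" by auto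
  \<comment> \<open>This is the homothety with centre \<open>p\<close> and ratio
    \<open>1 / (1 + \<epsilon>)\<close>; its inverse is the affine map in the conclusion, with
    \<open>a = - \<epsilon> *\<^sub>R p\<close>.\<close>
  let ?s = "\<lambda>x. x - (\<epsilon> / (1 + \<epsilon>)) *\<^sub>R (x - p)"
  have s_int: "?s x \<in> interior K" if "x \<in> K" for x
    by (rule mem_interior_convex_shrink[OF cK(2) p that]) (use \<epsilon> in auto)
  have "\<exists>a b. cbox a b \<subseteq> interior K \<and> x \<in> box a b" if "x \<in> interior K" for x
    using open_contains_cbox[OF open_interior that] by metis
  then obtain a b where ab: "\<And>x. x \<in> interior K \<Longrightarrow> cbox (a x) (b x) \<subseteq> interior K \<and> x \<in> box (a x) (b x)"
    by metis
  have "compact (?s ` K)"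
    by (intro compact_continuous_image cK(1) continuous_intros)
  moreover have "?s ` K \<subseteq> (\<Union>x\<in>interior K. box (a x) (b x))"
    using ab s_int by blast
  ultimately obtain D where D: "D \<subseteq> interior K" "finite D" "?s ` K \<subseteq> (\<Union>x\<in>D. box (a x) (b x))"
    by (rule compactE_image[OF _ open_box])
  have "\<exists>V. finite V \<and> cbox (a x) (b x) = convex hull V" for x
    using closed_interval_as_convex_hull[of "a x" "b x"] by metis
  then obtain V where V: "\<And>x. finite (V x)" "\<And>x. cbox (a x) (b x) = convex hull (V x)"
    by metis
  define F where "F = (\<Union>x\<in>D. V x)"
  have box: "cbox (a x) (b x) \<subseteq> convex hull F" if "x \<in> D" for x
    unfolding V by (rule hull_mono) (use that in \<open>auto simp: F_def\<close>)
  have cover: "?s ` K \<subseteq> (\<Union>x\<in>D. box (a x) (b x))" by (rule D)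
  show thesis
  proof (rule that)
    show "finite F" using D V by (simp add: F_def)
    have "V x \<subseteq> K" if "x \<in> D" for x
    proof -
      have "V x \<subseteq> cbox (a x) (b x)" unfolding V by (rule hull_subset)
      also have "\<dots> \<subseteq> interior K" using ab D(1) that by blast
      also have "\<dots> \<subseteq> K" by (rule interior_subset)
      finally show ?thesis .
    qed
    then show "convex hull F \<subseteq> K"
      by (intro hull_minimal cK) (auto simp: F_def)
    have "p \<in> K" using p interior_subset by blast
    then have "?s p \<in> (\<Union>x\<in>D. box (a x) (b x))" using cover by (rule subsetD[OF _ imageI, rotated])
    then obtain x where x: "x \<in> D" "box (a x) (b x) \<noteq> {}" by blast
    have "box (a x) (b x) \<subseteq> interior (convex hull F)"
      using subset_trans[OF box_subset_cbox box[OF x(1)]] by (rule interior_maximal[OF _ open_box])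
    with x(2) show "interior (convex hull F) \<noteq> {}" by blast
    show "K \<subseteq> (\<lambda>x. (1 + \<epsilon>) *\<^sub>R x + (- \<epsilon> *\<^sub>R p)) ` (convex hull F)"
    proof
      fix x assume "x \<in> K"
      then have "?s x \<in> (\<Union>x\<in>D. box (a x) (b x))"
        using cover by (rule subsetD[OF _ imageI, rotated])
      then obtain z where "z \<in> D" "?s x \<in> box (a z) (b z)" by blast
      then have "?s x \<in> convex hull F"
        using box box_subset_cbox by blast
      moreover have "x = (1 + \<epsilon>) *\<^sub>R ?s x + (- \<epsilon> *\<^sub>R p)"
      proof -
        have "(1 + \<epsilon>) *\<^sub>R ?s x = (1 + \<epsilon>) *\<^sub>R x - \<epsilon> *\<^sub>R (x - p)"
          using \<epsilon> by (simp add: scaleR_diff_right[of "1 + \<epsilon>"])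
        then show ?thesis by (simp add: algebra_simps)
      qed
      ultimately show "x \<in> (\<lambda>x. (1 + \<epsilon>) *\<^sub>R x + (- \<epsilon> *\<^sub>R p)) ` (convex hull F)" by blast
    qed
  qed
qed

text \<open>The dilation factor is the same for every summand and the translations add up, so the
  larger sum lies in one dilated and translated copy of the smaller.\<close>

lemma volume_sum_sandwich:
  fixes K P :: "'b \<Rightarrow> 'a::euclidean_space set"
  assumes I: "finite I" and c: "\<And>i. i \<in> I \<Longrightarrow> 0 \<le> c i" and "0 \<le> \<epsilon>"
    and K: "\<And>i. i \<in> I \<Longrightarrow> compact (K i)" and P: "\<And>i. i \<in> I \<Longrightarrow> compact (P i)"
    and PK: "\<And>i. i \<in> I \<Longrightarrow> P i \<subseteq> K i"
    and KP: "\<And>i. i \<in> I \<Longrightarrow> K i \<subseteq> (\<lambda>x. (1 + \<epsilon>) *\<^sub>R x + a i) ` P i"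
  shows "measure lebesgue (\<Sum>i\<in>I. (*\<^sub>R) (c i) ` P i) \<le> measure lebesgue (\<Sum>i\<in>I. (*\<^sub>R) (c i) ` K i)"
    and "measure lebesgue (\<Sum>i\<in>I. (*\<^sub>R) (c i) ` K i) \<le>
      (1 + \<epsilon>) ^ DIM('a) * measure lebesgue (\<Sum>i\<in>I. (*\<^sub>R) (c i) ` P i)"
proof -
  let ?K = "\<Sum>i\<in>I. (*\<^sub>R) (c i) ` K i" and ?P = "\<Sum>i\<in>I. (*\<^sub>R) (c i) ` P i"
  have cK: "compact ?K" and cP: "compact ?P"
    using K P by (auto intro!: compact_set_sum compact_scaling)
  have "?P \<subseteq> ?K"
  proof
    fix x assume "x \<in> ?P"
    then obtain s where "x = (\<Sum>i\<in>I. s i)" "\<forall>i\<in>I. s i \<in> (*\<^sub>R) (c i) ` P i"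
      unfolding mem_set_sum[OF I] by blast
    moreover from this PK have "\<forall>i\<in>I. s i \<in> (*\<^sub>R) (c i) ` K i" by blast
    ultimately show "x \<in> ?K" unfolding mem_set_sum[OF I] by blast
  qed
  then show "measure lebesgue ?P \<le> measure lebesgue ?K"
    by (intro measure_mono_fmeasurable fmeasurableD lmeasurable_compact cK cP)
  let ?T = "\<lambda>x. (1 + \<epsilon>) *\<^sub>R x + (\<Sum>i\<in>I. c i *\<^sub>R a i)"
  have "?K \<subseteq> ?T ` ?P"
  proof
    fix x assume "x \<in> ?K"
    then obtain s where s: "x = (\<Sum>i\<in>I. s i)" "\<forall>i\<in>I. s i \<in> (*\<^sub>R) (c i) ` K i"
      unfolding mem_set_sum[OF I] by blast
    have "\<forall>i\<in>I. \<exists>y. y \<in> P i \<and> s i = c i *\<^sub>R ((1 + \<epsilon>) *\<^sub>R y + a i)"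
      using s(2) KP by blast
    then obtain y where y: "\<And>i. i \<in> I \<Longrightarrow> y i \<in> P i \<and> s i = c i *\<^sub>R ((1 + \<epsilon>) *\<^sub>R y i + a i)"
      by metis
    have "x = (\<Sum>i\<in>I. c i *\<^sub>R ((1 + \<epsilon>) *\<^sub>R y i + a i))"
      unfolding s(1) by (rule sum.cong) (use y in auto)
    also have "\<dots> = ?T (\<Sum>i\<in>I. c i *\<^sub>R y i)"
      by (simp add: scaleR_right_distrib sum.distrib scaleR_sum_right mult.commute)
    finally have "x = ?T (\<Sum>i\<in>I. c i *\<^sub>R y i)" .
    moreover have "(\<Sum>i\<in>I. c i *\<^sub>R y i) \<in> ?P"
      unfolding mem_set_sum[OF I] using y by blast
    ultimately show "x \<in> ?T ` ?P" by blast
  qed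
  moreover have "compact (?T ` ?P)"
    by (intro compact_continuous_image cP continuous_intros)
  ultimately have "measure lebesgue ?K \<le> measure lebesgue (?T ` ?P)"
    by (intro measure_mono_fmeasurable fmeasurableD lmeasurable_compact cK)
  also have "\<dots> = (1 + \<epsilon>) ^ DIM('a) * measure lebesgue ?P"
    using \<open>0 \<le> \<epsilon>\<close> by (subst measure_lebesgue_affine) auto
  finally show "measure lebesgue ?K \<le> (1 + \<epsilon>) ^ DIM('a) * measure lebesgue ?P" .
qed

lemma volume_sum_tendsto:
  fixes K :: "'b \<Rightarrow> 'a::euclidean_space set" and P :: "nat \<Rightarrow> 'b \<Rightarrow> 'a set"
  assumes I: "finite I" and c: "\<And>i. i \<in> I \<Longrightarrow> 0 \<le> c i"
    and K: "\<And>i. i \<in> I \<Longrightarrow> compact (K i)" and P: "\<And>i k. i \<in> I \<Longrightarrow> compact (P k i)"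
    and PK: "\<And>i k. i \<in> I \<Longrightarrow> P k i \<subseteq> K i"
    and KP: "\<And>i k. i \<in> I \<Longrightarrow> K i \<subseteq> (\<lambda>x. (1 + inverse (real (Suc k))) *\<^sub>R x + a k i) ` P k i"
  shows "(\<lambda>k. measure lebesgue (\<Sum>i\<in>I. (*\<^sub>R) (c i) ` P k i)) \<longlonglongrightarrow>
    measure lebesgue (\<Sum>i\<in>I. (*\<^sub>R) (c i) ` K i)"
proof (rule tendsto_sandwich)
  let ?K = "measure lebesgue (\<Sum>i\<in>I. (*\<^sub>R) (c i) ` K i)"
  let ?d = "\<lambda>k. (1 + inverse (real (Suc k))) ^ DIM('a)"
  have "(\<lambda>k. ?K / ?d k) \<longlonglongrightarrow> ?K / (1 + 0) ^ DIM('a)"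
    by (intro tendsto_intros LIMSEQ_inverse_real_of_nat) simp
  then show "(\<lambda>k. ?K / ?d k) \<longlonglongrightarrow> ?K" by simp
  show "\<forall>\<^sub>F k in sequentially. ?K / ?d k \<le> measure lebesgue (\<Sum>i\<in>I. (*\<^sub>R) (c i) ` P k i)"
  proof (intro always_eventually allI)
    fix k
    have "?K \<le> ?d k * measure lebesgue (\<Sum>i\<in>I. (*\<^sub>R) (c i) ` P k i)"
      by (rule volume_sum_sandwich(2)[OF I c _ K P PK KP]) auto
    moreover have "0 < ?d k" by (intro zero_less_power) (simp add: add_pos_pos)
    ultimately show "?K / ?d k \<le> measure lebesgue (\<Sum>i\<in>I. (*\<^sub>R) (c i) ` P k i)"
      by (simp add: pos_divide_le_eq mult.commute)
  qed
  show "\<forall>\<^sub>F k in sequentially. measure lebesgue (\<Sum>i\<in>I. (*\<^sub>R) (c i) ` P k i) \<le> ?K"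
    by (intro always_eventually allI volume_sum_sandwich(1)[OF I c _ K P PK KP]) auto
qed simp

lemma convex_body_imp_compact: "convex_body K \<Longrightarrow> compact K"
  by (simp add: convex_body_def)

lemma polar_tendsto:
  assumes "\<And>S. ((\<lambda>k. p k S) \<longlongrightarrow> q S) G"
  shows "((\<lambda>k. polar (p k)) \<longlongrightarrow> polar q) G"
  unfolding polar_def by (intro tendsto_intros assms) simp

text \<open>Minkowski's theorem. The summands are approximated by inscribed polytopes, and both
  sides converge because each consists of finitely many volumes of Minkowski sums.\<close>

theorem volume_sum_convex_bodies:
  fixes K :: "'b \<Rightarrow> (real^'n::finite) set"
  assumes I: "finite I" and c: "\<And>i. i \<in> I \<Longrightarrow> 0 \<le> c i"
    and K: "\<And>i. i \<in> I \<Longrightarrow> convex_body (K i)"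
  shows "measure lebesgue (\<Sum>i\<in>I. (*\<^sub>R) (c i) ` K i) =
    (\<Sum>f\<in>UNIV \<rightarrow> I. (\<Prod>i\<in>UNIV. c (f i)) * polar_volume (\<lambda>i. K (f i)))"
proof -
  define Q where "Q i k X b \<longleftrightarrow> finite X \<and> interior (convex hull X) \<noteq> {} \<and> convex hull X \<subseteq> K i \<and>
      K i \<subseteq> (\<lambda>x. (1 + inverse (real (Suc k))) *\<^sub>R x + b) ` (convex hull X)" for i k X b
  have "\<exists>X b. Q i k X b" if i: "i \<in> I" for i k
  proof -
    have "0 < inverse (real (Suc k))" by simp
    from convex_body_polytope_approx[OF K[OF i] this] obtain X b where "Q i k X b"
      unfolding Q_def by metis
    then show ?thesis by (intro exI)
  qed
  then obtain F' a' where Q: "\<And>i k. i \<in> I \<Longrightarrow> Q i k (F' i k) (a' i k)"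
    by metis
  define F where "F k i = F' i k" for k i
  define a where "a k i = a' i k" for k i
  have F: "finite (F k i)" "interior (convex hull F k i) \<noteq> {}" "convex hull F k i \<subseteq> K i"
      "K i \<subseteq> (\<lambda>x. (1 + inverse (real (Suc k))) *\<^sub>R x + a k i) ` (convex hull F k i)"
    if "i \<in> I" for i k
    using Q[OF that, of k] by (simp_all only: Q_def F_def a_def not_False_eq_True)
  have comp: "compact (convex hull F k i)" "compact (K i)" if "i \<in> I" for i k
    using that F(1) K by (auto intro: finite_imp_compact_convex_hull convex_body_imp_compact)
  have "(\<lambda>k. polar_volume (\<lambda>i. convex hull F k (f i))) \<longlonglongrightarrow> polar_volume (\<lambda>i. K (f i))"
    if f: "f \<in> (UNIV :: 'n set) \<rightarrow> I" for f
    unfolding polar_volume_def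
  proof (rule polar_tendsto)
    fix S :: "'n set"
    show "(\<lambda>k. measure lebesgue (\<Sum>i\<in>S. convex hull F k (f i))) \<longlonglongrightarrow> measure lebesgue (\<Sum>i\<in>S. K (f i))"
    proof -
      have f: "f i \<in> I" for i using f by auto
      have "(\<lambda>k. measure lebesgue (\<Sum>i\<in>S. (*\<^sub>R) 1 ` (convex hull F k (f i))))
          \<longlonglongrightarrow> measure lebesgue (\<Sum>i\<in>S. (*\<^sub>R) 1 ` K (f i))"
        by (rule volume_sum_tendsto[OF _ _ comp(2)[OF f] comp(1)[OF f] F(3,4)[OF f]]) auto
      then show ?thesis by simp
    qed
  qed
  then have "(\<lambda>k. \<Sum>f\<in>(UNIV :: 'n set) \<rightarrow> I. (\<Prod>i\<in>UNIV. c (f i)) * polar_volume (\<lambda>i. convex hull F k (f i)))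
      \<longlonglongrightarrow> (\<Sum>f\<in>UNIV \<rightarrow> I. (\<Prod>i\<in>UNIV. c (f i)) * polar_volume (\<lambda>i. K (f i)))"
    by (intro tendsto_sum tendsto_mult_left)
  moreover have "measure lebesgue (\<Sum>i\<in>I. (*\<^sub>R) (c i) ` (convex hull F k i)) =
      (\<Sum>f\<in>UNIV \<rightarrow> I. (\<Prod>i\<in>UNIV. c (f i)) * polar_volume (\<lambda>i. convex hull F k (f i)))" for k
    by (rule volume_sum_polytopes[OF I c F(1,2)])
  ultimately have "(\<lambda>k. measure lebesgue (\<Sum>i\<in>I. (*\<^sub>R) (c i) ` (convex hull F k i)))
      \<longlonglongrightarrow> (\<Sum>f\<in>UNIV \<rightarrow> I. (\<Prod>i\<in>UNIV. c (f i)) * polar_volume (\<lambda>i. K (f i)))"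
    by simp
  moreover have "(\<lambda>k. measure lebesgue (\<Sum>i\<in>I. (*\<^sub>R) (c i) ` (convex hull F k i)))
      \<longlonglongrightarrow> measure lebesgue (\<Sum>i\<in>I. (*\<^sub>R) (c i) ` K i)"
    by (rule volume_sum_tendsto[OF I c comp(2) comp(1) F(3,4)])
  ultimately show ?thesis by (rule LIMSEQ_unique[symmetric])
qed

section \<open>Symmetry, characterisation and homogeneity of the polarized volume\<close>

lemma polar_volume_permute:
  assumes "\<pi> permutes UNIV"
  shows "polar_volume (K \<circ> \<pi>) = polar_volume K"
proof -
  have inj: "inj_on \<pi> S" for S using assms permutes_inj inj_on_subset by blast
  have "polar_volume (K \<circ> \<pi>) = polar (\<lambda>S. measure lebesgue (\<Sum>i\<in>\<pi> ` S. K i))"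
    by (simp add: polar_volume_def sum.reindex[OF inj])
  also have "\<dots> = polar_volume K"
    unfolding polar_volume_def by (rule polar_reindex) (rule permutes_bij[OF assms])
  finally show ?thesis .
qed

lemma is_mixed_volume_polar_volume:
  "is_mixed_volume (restrict polar_volume {K. \<forall>i. convex_body (K i)})"
  unfolding is_mixed_volume_def
proof (intro conjI allI impI)
  fix K :: "'n \<Rightarrow> (real^'n) set" and \<pi> :: "'n \<Rightarrow> 'n"
  assume "(\<forall>i. convex_body (K i)) \<and> \<pi> permutes UNIV"
  then show "restrict polar_volume {K. \<forall>i. convex_body (K i)} (K \<circ> \<pi>) =
      restrict polar_volume {K. \<forall>i. convex_body (K i)} K"
    by (simp add: polar_volume_permute)
next
  fix m :: nat and K :: "nat \<Rightarrow> (real^'n) set" and c :: "nat \<Rightarrow> real"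
  assume *: "\<forall>j<m. convex_body (K j) \<and> 0 \<le> c j"
  have "measure lebesgue (\<Sum>j<m. (*\<^sub>R) (c j) ` K j) =
      (\<Sum>f\<in>UNIV \<rightarrow> {..<m}. (\<Prod>i\<in>UNIV. c (f i)) * polar_volume (\<lambda>i. K (f i)))"
    using * by (intro volume_sum_convex_bodies) auto
  also have "\<dots> = (\<Sum>f\<in>UNIV \<rightarrow> {..<m}.
      restrict polar_volume {K. \<forall>i. convex_body (K i)} (\<lambda>i. K (f i)) * (\<Prod>i\<in>UNIV. c (f i)))"
    using * by (intro sum.cong) (auto simp: Pi_iff)
  finally show "measure lebesgue (\<Sum>j<m. (*\<^sub>R) (c j) ` K j) = (\<Sum>f\<in>UNIV \<rightarrow> {..<m}.
      restrict polar_volume {K. \<forall>i. convex_body (K i)} (\<lambda>i. K (f i)) * (\<Prod>i\<in>UNIV. c (f i)))" .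
qed (rule restrict_extensional)

text \<open>The expansion with unit coefficients writes the volume of each partial sum over
  \<open>S\<close> as a sum of \<open>V\<close> over multi-indices in \<open>S\<close>. Polarization
  keeps only the permutations, and by symmetry each of these contributes \<open>V K\<close>.\<close>

lemma is_mixed_volume_eq_polar_volume:
  fixes K :: "'n::finite \<Rightarrow> (real^'n) set"
  assumes V: "is_mixed_volume V" and K: "\<And>i. convex_body (K i)"
  shows "V K = polar_volume K"
proof -
  have "measure lebesgue (\<Sum>i\<in>S. K i) = (\<Sum>f\<in>UNIV \<rightarrow> S. V (K \<circ> f))" for S :: "'n set"
  proof -
    \<comment> \<open>The defining expansion is indexed by naturals below \<open>m\<close>, so
      \<open>S\<close> is enumerated with \<open>m = card S\<close>.\<close>
    obtain e where e: "bij_betw e {0..<card S} S"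
      using ex_bij_betw_nat_finite[of S] by auto
    then have e: "bij_betw e {..<card S} S" by (simp add: atLeast0LessThan)
    have "measure lebesgue (\<Sum>i\<in>S. K i) = measure lebesgue (\<Sum>j<card S. (*\<^sub>R) 1 ` K (e j))"
      by (simp add: sum.reindex_bij_betw[OF e])
    also have "\<dots> = (\<Sum>f\<in>UNIV \<rightarrow> {..<card S}. V (\<lambda>i. K (e (f i))) * (\<Prod>i\<in>(UNIV::'n set). 1))"
      using V K unfolding is_mixed_volume_def by (elim conjE allE[of _ "card S"] allE[of _ "\<lambda>j. K (e j)"] allE[of _ "\<lambda>_. 1"]) simp
    also have "\<dots> = (\<Sum>f\<in>UNIV \<rightarrow> S. V (K \<circ> f))"
    proof (rule sum.reindex_bij_witness[of _ "\<lambda>f. inv_into {..<card S} e \<circ> f" "\<lambda>f. e \<circ> f"])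
      fix f assume f: "f \<in> (UNIV :: 'n set) \<rightarrow> {..<card S}"
      show "inv_into {..<card S} e \<circ> (e \<circ> f) = f"
        using f bij_betw_inv_into_left[OF e] by (auto simp: fun_eq_iff)
      show "e \<circ> f \<in> UNIV \<rightarrow> S" using f bij_betwE[OF e] by auto
    next
      fix f assume f: "f \<in> (UNIV :: 'n set) \<rightarrow> S"
      show "e \<circ> (inv_into {..<card S} e \<circ> f) = f"
        using f bij_betw_inv_into_right[OF e] by (auto simp: fun_eq_iff)
      show "inv_into {..<card S} e \<circ> f \<in> UNIV \<rightarrow> {..<card S}"
        using f bij_betwE[OF bij_betw_inv_into[OF e]] by auto
    qed (simp add: o_def)
    finally show ?thesis .
  qed
  then have "polar_volume K = (\<Sum>\<pi> | \<pi> permutes UNIV. V (K \<circ> \<pi>)) / fact CARD('n)"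
    unfolding polar_volume_def by (rule polar_expansion)
  also have "(\<Sum>\<pi> | \<pi> permutes UNIV. V (K \<circ> \<pi>)) = (\<Sum>\<pi> | \<pi> permutes (UNIV :: 'n set). V K)"
    using V K by (intro sum.cong) (auto simp: is_mixed_volume_def)
  finally show ?thesis by (simp add: card_permutations)
qed

text \<open>Existence and uniqueness together make the definite description denote a mixed
  volume.\<close>

theorem mixed_volume_eq_polar_volume:
  fixes K :: "'n::finite \<Rightarrow> (real^'n) set"
  assumes "\<And>i. convex_body (K i)"
  shows "mixed_volume K = polar_volume K"
proof -
  have "is_mixed_volume (mixed_volume :: ('n \<Rightarrow> (real^'n) set) \<Rightarrow> real)"
    unfolding mixed_volume_def
  proof (rule theI[where P = is_mixed_volume, OF is_mixed_volume_polar_volume])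
    fix V :: "('n \<Rightarrow> (real^'n) set) \<Rightarrow> real"
    assume V: "is_mixed_volume V"
    show "V = restrict polar_volume {K. \<forall>i. convex_body (K i)}"
    proof (rule extensionalityI)
      show "V \<in> extensional {K. \<forall>i. convex_body (K i)}"
        using V unfolding is_mixed_volume_def by blast
      fix K :: "'n \<Rightarrow> (real^'n) set" assume "K \<in> {K. \<forall>i. convex_body (K i)}"
      then show "V K = restrict polar_volume {K. \<forall>i. convex_body (K i)} K"
        using is_mixed_volume_eq_polar_volume[OF V, of K] by simp
    qed (rule restrict_extensional)
  qed
  then show ?thesis using assms by (rule is_mixed_volume_eq_polar_volume)
qed

text \<open>Minkowski's expansion of the scaled sums is polarized: only permutations remain, and
  neither the product of the \<open>a i\<close> nor the polarized volume changes under a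
  permutation.\<close>

lemma polar_volume_scale:
  fixes K :: "'n::finite \<Rightarrow> (real^'n) set"
  assumes K: "\<And>i. convex_body (K i)" and a: "\<And>i. 0 \<le> a i"
  shows "polar_volume (\<lambda>i. (*\<^sub>R) (a i) ` K i) = (\<Prod>i\<in>UNIV. a i) * polar_volume K"
proof -
  have "polar_volume (\<lambda>i. (*\<^sub>R) (a i) ` K i) =
      (\<Sum>\<pi> | \<pi> permutes UNIV. (\<Prod>i\<in>UNIV. a (\<pi> i)) * polar_volume (\<lambda>i. K (\<pi> i))) / fact CARD('n)"
    unfolding polar_volume_def[of "\<lambda>i. (*\<^sub>R) (a i) ` K i"]
    using K a by (intro polar_expansion volume_sum_convex_bodies) auto
  also have "(\<Sum>\<pi> | \<pi> permutes UNIV. (\<Prod>i\<in>UNIV. a (\<pi> i)) * polar_volume (\<lambda>i. K (\<pi> i))) =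
      (\<Sum>\<pi> | \<pi> permutes (UNIV :: 'n set). (\<Prod>i\<in>UNIV. a i) * polar_volume K)"
  proof (rule sum.cong)
    fix \<pi> assume "\<pi> \<in> {\<pi>. \<pi> permutes (UNIV :: 'n set)}"
    then show "(\<Prod>i\<in>UNIV. a (\<pi> i)) * polar_volume (\<lambda>i. K (\<pi> i)) = (\<Prod>i\<in>UNIV. a i) * polar_volume K"
      using prod.permute[of \<pi> UNIV a] polar_volume_permute[of \<pi> K] by (simp add: o_def)
  qed simp
  finally show ?thesis by (simp add: card_permutations)
qed

section \<open>Support functions and degenerating linear maps\<close>

definition support_fun :: "'a::real_inner set \<Rightarrow> 'a \<Rightarrow> real" where
  "support_fun K \<xi> = (SUP x\<in>K. \<xi> \<bullet> x)"

lemma support_fun_attained: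
  assumes "compact K" "K \<noteq> {}"
  obtains x where "x \<in> K" "\<xi> \<bullet> x = support_fun K \<xi>" "\<And>y. y \<in> K \<Longrightarrow> \<xi> \<bullet> y \<le> support_fun K \<xi>"
proof -
  have "continuous_on K (\<lambda>x. \<xi> \<bullet> x)" by (intro continuous_intros)
  then obtain x where x: "x \<in> K" "\<And>y. y \<in> K \<Longrightarrow> \<xi> \<bullet> y \<le> \<xi> \<bullet> x"
    using continuous_attains_sup[OF assms] by metis
  then have "support_fun K \<xi> = \<xi> \<bullet> x"
    unfolding support_fun_def by (intro cSup_eq_maximum) auto
  with x that show thesis by simp
qed

lemma support_fun_upper: "compact K \<Longrightarrow> x \<in> K \<Longrightarrow> \<xi> \<bullet> x \<le> support_fun K \<xi>"
  by (metis support_fun_attained empty_iff)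

lemma centrally_symmetric_uminus: "centrally_symmetric K \<Longrightarrow> x \<in> K \<Longrightarrow> - x \<in> K"
  unfolding centrally_symmetric_def by (metis imageI)

lemma support_fun_uminus:
  assumes "centrally_symmetric K"
  shows "support_fun K (- \<xi>) = support_fun K \<xi>"
proof -
  have "(\<lambda>x. \<xi> \<bullet> x) ` K = (\<lambda>x. \<xi> \<bullet> x) ` uminus ` K"
    using assms unfolding centrally_symmetric_def by (rule arg_cong)
  then show ?thesis by (simp add: support_fun_def image_image)
qed

lemma abs_inner_le_support_fun:
  assumes "compact K" "centrally_symmetric K" "x \<in> K"
  shows "\<bar>\<xi> \<bullet> x\<bar> \<le> support_fun K \<xi>"
  using support_fun_upper[OF assms(1,3), of \<xi>]
    support_fun_upper[OF assms(1) centrally_symmetric_uminus[OF assms(2,3)], of \<xi>]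
  by (simp add: abs_le_iff)

text \<open>The origin is the midpoint of an interior point and its reflection, which is interior as
  well.\<close>

lemma symmetric_convex_body_cball:
  fixes K :: "'a::euclidean_space set"
  assumes "convex_body K" "centrally_symmetric K"
  obtains r where "0 < r" "cball 0 r \<subseteq> K"
proof -
  obtain x where x: "x \<in> interior K" using assms(1) by (auto simp: convex_body_def)
  have "uminus ` interior K = interior K"
    using assms(2) interior_negations[of K] unfolding centrally_symmetric_def by metis
  then have "- x \<in> interior K" using x by blast
  moreover have "convex (interior K)"
    using assms(1) by (simp add: convex_body_def convex_interior)
  ultimately have "(1/2) *\<^sub>R x + (1/2) *\<^sub>R (- x) \<in> interior K"
    using x by (intro convexD) auto
  then have "0 \<in> interior K" by simp
  then show thesis using that by (auto simp: mem_interior_cball)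
qed

lemma support_fun_ge_norm:
  fixes K :: "'a::euclidean_space set"
  assumes "compact K" "cball 0 r \<subseteq> K" "0 \<le> r"
  shows "r * norm \<xi> \<le> support_fun K \<xi>"
proof -
  have "r *\<^sub>R sgn \<xi> \<in> K"
    using assms by (intro subsetD[OF assms(2)]) (simp add: norm_sgn)
  then have "\<xi> \<bullet> (r *\<^sub>R sgn \<xi>) \<le> support_fun K \<xi>"
    by (rule support_fun_upper[OF assms(1)])
  moreover have "\<xi> \<bullet> sgn \<xi> = norm \<xi>"
    by (cases "\<xi> = 0") (simp_all add: sgn_div_norm dot_square_norm power2_eq_square)
  ultimately show ?thesis by simp
qed

text \<open>A point of \<open>A\<close> outside \<open>s B\<close> would be strictly separated from
  it, violating the inequality in the normal direction.\<close>

lemma subset_scaleR_of_support_fun_le: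
  fixes A B :: "'a::euclidean_space set"
  assumes A: "compact A" and B: "compact B" "convex B" "B \<noteq> {}"
    and le: "\<And>\<xi>. \<xi> \<noteq> 0 \<Longrightarrow> support_fun A \<xi> \<le> s * support_fun B \<xi>"
  shows "A \<subseteq> (*\<^sub>R) s ` B"
proof (rule subsetI, rule ccontr)
  fix x assume x: "x \<in> A" "x \<notin> (*\<^sub>R) s ` B"
  have "convex ((*\<^sub>R) s ` B)" "closed ((*\<^sub>R) s ` B)"
    using B by (simp_all add: convex_scaling closed_scaling compact_imp_closed)
  from separating_hyperplane_closed_point[OF this x(2)]
  obtain a b where ab: "a \<bullet> x < b" "\<forall>y\<in>(*\<^sub>R) s ` B. b < a \<bullet> y"
    by blast
  \<comment> \<open>The separation puts \<open>x\<close> on the lower side, so the direction to test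
    is \<open>- a\<close>.\<close>
  obtain y where y: "y \<in> B" "(- a) \<bullet> y = support_fun B (- a)"
    using support_fun_attained[OF B(1,3)] by metis
  have *: "b < a \<bullet> (s *\<^sub>R y)" using ab(2) y(1) by blast
  with ab(1) have "a \<noteq> 0" by auto
  then have "support_fun A (- a) \<le> s * ((- a) \<bullet> y)" using le[of "- a"] y by simp
  moreover have "(- a) \<bullet> x \<le> support_fun A (- a)" by (rule support_fun_upper[OF A x(1)])
  ultimately show False using * ab(1) by simp
qed

section \<open>Invertible maps degenerating to rank one\<close>

text \<open>The rank one map with image spanned by the \<open>i\<close>-th axis, perturbed by
  \<open>\<delta>\<close> times the identity so that it can be normalised to determinant one before
  \<open>\<delta>\<close> tends to 0.\<close>

definition stretch :: "'n::finite \<Rightarrow> real^'n \<Rightarrow> real \<Rightarrow> real^'n \<Rightarrow> real^'n" where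
  "stretch i \<xi> \<delta> x = (\<xi> \<bullet> x) *\<^sub>R axis i 1 + \<delta> *\<^sub>R x"

lemma linear_stretch: "linear (stretch i \<xi> \<delta>)"
  by (rule linearI) (simp_all add: stretch_def inner_add_right algebra_simps)

lemma compact_stretch: "compact K \<Longrightarrow> compact (stretch i \<xi> \<delta> ` K)"
  unfolding stretch_def[abs_def] by (intro compact_continuous_image continuous_intros)

text \<open>The matrix is \<open>\<delta>\<close> times the identity (\<open>A\<close>) with row
  \<open>i\<close> replaced by the combination of the rows of \<open>A\<close> with coefficients
  \<open>x\<close>. Cramer's rule gives the determinant \<open>x $ i * \<delta> ^ CARD('n)\<close>,
  and \<open>x $ i\<close> is positive since \<open>\<xi> $ i\<close> is nonnegative.\<close>

lemma det_stretch_pos: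
  fixes \<xi> :: "real^'n::finite"
  assumes "0 < \<delta>" "0 \<le> \<xi> $ i"
  shows "0 < det (matrix (stretch i \<xi> \<delta>))"
proof -
  define A :: "real^'n^'n" where "A = (\<chi> r. \<delta> *s axis r 1)"
  define x where "x = (1 / \<delta>) *\<^sub>R (\<xi> + \<delta> *\<^sub>R axis i 1)"
  have "det A = \<delta> ^ CARD('n) * det ((\<chi> r. axis r 1) :: real^'n^'n)"
    unfolding A_def by (subst det_rows_mul) simp
  also have "((\<chi> r. axis r 1) :: real^'n^'n) = mat 1"
    by (simp add: vec_eq_iff mat_def axis_def)
  finally have A: "det A = \<delta> ^ CARD('n)" by simp
  have row: "row k A $ j = (if j = k then \<delta> else 0)" for k j
    by (simp add: A_def row_def axis_def)
  have "(\<Sum>k\<in>UNIV. x $ k *s row k A) = \<delta> *\<^sub>R x"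
    by (simp add: vec_eq_iff row if_distrib[where f = "(*) _"] cong: if_cong)
  also have "\<dots> = \<xi> + \<delta> *\<^sub>R axis i 1"
    using assms by (simp add: x_def)
  finally have "(\<Sum>k\<in>UNIV. x $ k *s row k A) = \<xi> + \<delta> *\<^sub>R axis i 1" .
  moreover have "matrix (stretch i \<xi> \<delta>) $ r = \<xi> + \<delta> *\<^sub>R axis i 1" if "r = i" for r
    using that by (simp add: vec_eq_iff matrix_def stretch_def inner_axis) (simp add: axis_def)
  moreover have "matrix (stretch i \<xi> \<delta>) $ r = row r A" if "r \<noteq> i" for r
    using that by (simp add: vec_eq_iff matrix_def stretch_def row) (simp add: axis_def)
  ultimately have "matrix (stretch i \<xi> \<delta>) =
      (\<chi> r. if r = i then \<Sum>k\<in>UNIV. x $ k *s row k A else row r A)"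
    by (simp add: vec_eq_iff[of "matrix _"])
  then have "det (matrix (stretch i \<xi> \<delta>)) = x $ i * \<delta> ^ CARD('n)"
    by (simp only: cramer_lemma_transpose A)
  also have "\<dots> > 0"
    using assms by (intro mult_pos_pos) (auto simp: x_def add_nonneg_pos)
  finally show ?thesis .
qed

lemma measure_cbox_uminus:
  fixes b :: "real^'n::finite"
  assumes "\<And>i. 0 \<le> b $ i"
  shows "measure lebesgue (cbox (- b) b) = (\<Prod>i\<in>UNIV. 2 * b $ i)"
proof -
  have "cbox (- b) b \<noteq> {}"
    using order_trans[OF neg_le_0_iff_le[THEN iffD2, OF assms] assms] assms by (simp add: interval_ne_empty_cart)
  then show ?thesis by (simp add: content_cbox_cart)
qed

context
  fixes K :: "'n::finite \<Rightarrow> (real^'n) set" and \<xi> :: "'n \<Rightarrow> real^'n" and R :: real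
  assumes K: "\<And>i. convex_body (K i)" and sym: "\<And>i. centrally_symmetric (K i)"
    and R: "\<And>i x. x \<in> K i \<Longrightarrow> norm x \<le> R"
begin

private lemma comp: "compact (K i)" and conv: "convex (K i)" and ne: "K i \<noteq> {}"
  using K[of i] by (auto simp: convex_body_def)

private lemma R_nonneg: "0 \<le> R"
  using ne R norm_ge_zero order_trans by (metis all_not_in_conv)

text \<open>In coordinate \<open>k\<close> only the \<open>k\<close>-th rank one part contributes,
  at most its support function in absolute value by central symmetry; each of the at most n
  perturbations adds at most \<open>\<delta> * R\<close>.\<close>

lemma stretch_sum_subset_cbox:
  fixes S :: "'n set"
  assumes \<delta>: "0 \<le> \<delta>"
  defines "b \<equiv> \<chi> k. (if k \<in> S then support_fun (K k) (\<xi> k) else 0) + \<delta> * (CARD('n) * R)"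
  shows "(\<Sum>i\<in>S. stretch i (\<xi> i) \<delta> ` K i) \<subseteq> cbox (- b) b"
proof
  fix y assume "y \<in> (\<Sum>i\<in>S. stretch i (\<xi> i) \<delta> ` K i)"
  then obtain s where s: "y = (\<Sum>i\<in>S. s i)" "\<forall>i\<in>S. s i \<in> stretch i (\<xi> i) \<delta> ` K i"
    unfolding mem_set_sum[OF finite] by blast
  then have "\<forall>i\<in>S. \<exists>x. x \<in> K i \<and> s i = stretch i (\<xi> i) \<delta> x" by blast
  then obtain x where x: "\<And>i. i \<in> S \<Longrightarrow> x i \<in> K i \<and> s i = stretch i (\<xi> i) \<delta> (x i)" by metis
  have y: "y = (\<Sum>i\<in>S. stretch i (\<xi> i) \<delta> (x i))"
    unfolding s(1) by (rule sum.cong) (use x in auto)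
  have "\<bar>y $ k\<bar> \<le> b $ k" for k
  proof -
    have "y $ k = (\<Sum>i\<in>S. if i = k then \<xi> i \<bullet> x i else 0) + (\<Sum>i\<in>S. \<delta> * x i $ k)"
      by (simp add: y stretch_def axis_def sum.distrib if_distrib cong: if_cong)
    moreover have "\<bar>\<Sum>i\<in>S. if i = k then \<xi> i \<bullet> x i else 0\<bar> \<le> (if k \<in> S then support_fun (K k) (\<xi> k) else 0)"
      using abs_inner_le_support_fun[OF comp sym] x by (simp add: sum.delta')
    moreover have "\<bar>\<Sum>i\<in>S. \<delta> * x i $ k\<bar> \<le> \<delta> * (CARD('n) * R)"
    proof -
      have "\<bar>\<Sum>i\<in>S. \<delta> * x i $ k\<bar> \<le> (\<Sum>i\<in>S. \<delta> * R)"
      proof (rule order_trans[OF sum_abs], rule sum_mono)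
        fix i assume "i \<in> S"
        then have "\<bar>x i $ k\<bar> \<le> R"
          using x R component_le_norm_cart[of "x i" k] by (meson order_trans)
        then show "\<bar>\<delta> * x i $ k\<bar> \<le> \<delta> * R"
          using \<delta> by (simp add: abs_mult mult_left_mono)
      qed
      also have "\<dots> = card S * (\<delta> * R)" by simp
      also have "\<dots> \<le> CARD('n) * (\<delta> * R)"
        using \<delta> R_nonneg by (intro mult_right_mono) (auto intro: card_mono)
      finally show ?thesis by (simp add: mult_ac)
    qed
    ultimately show ?thesis unfolding b_def by simp
  qed
  then show "y \<in> cbox (- b) b" by (simp add: mem_box_cart abs_le_iff minus_le_iff)
qed

text \<open>By separation: a point of the box outside the sum would lie strictly below the whole sum
  in some direction \<open>a\<close>, but a suitable choice of extreme points gives a point of the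
  sum that is at least as low.\<close>

lemma cbox_subset_stretch_sum:
  assumes \<delta>: "0 \<le> \<delta>"
  defines "b \<equiv> \<chi> k. support_fun (K k) (\<xi> k) - \<delta> * (CARD('n) * R)"
  shows "cbox (- b) b \<subseteq> (\<Sum>i\<in>UNIV. stretch i (\<xi> i) \<delta> ` K i)" (is "_ \<subseteq> ?P")
proof (rule subsetI, rule ccontr)
  fix z assume z: "z \<in> cbox (- b) b" "z \<notin> ?P"
  have "compact ?P" "convex ?P"
    by (auto intro!: compact_set_sum convex_set_sum compact_stretch convex_linear_image
        linear_stretch comp conv)
  from separating_hyperplane_closed_point[OF this(2) compact_imp_closed[OF this(1)] z(2)]
  obtain a c where ac: "a \<bullet> z < c" "\<And>y. y \<in> ?P \<Longrightarrow> c < a \<bullet> y" by blast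
  \<comment> \<open>The sign makes \<open>\<sigma> i * a $ i = - \<bar>a $ i\<bar>\<close>, so the
    maximiser \<open>x i\<close> or its reflection pushes the sum as far as possible against
    \<open>a\<close>.\<close>
  define \<sigma> where "\<sigma> i = (if 0 \<le> a $ i then - 1 else (1::real))" for i
  have "\<exists>x. x \<in> K i \<and> \<xi> i \<bullet> x = support_fun (K i) (\<xi> i)" for i
    by (metis support_fun_attained[OF comp ne])
  then obtain x where x: "\<And>i. x i \<in> K i" "\<And>i. \<xi> i \<bullet> x i = support_fun (K i) (\<xi> i)" by metis
  have "\<sigma> i *\<^sub>R x i \<in> K i" for i
    using x(1) centrally_symmetric_uminus[OF sym] by (simp add: \<sigma>_def)
  then have "(\<Sum>i\<in>UNIV. stretch i (\<xi> i) \<delta> (\<sigma> i *\<^sub>R x i)) \<in> ?P"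
    unfolding mem_set_sum[OF finite] by blast
  from ac(2)[OF this] have "c < (\<Sum>i\<in>UNIV. a \<bullet> stretch i (\<xi> i) \<delta> (\<sigma> i *\<^sub>R x i))"
    by (simp add: inner_sum_right)
  also have "\<dots> \<le> (\<Sum>i\<in>UNIV. - (\<bar>a $ i\<bar> * support_fun (K i) (\<xi> i)) + \<delta> * ((\<Sum>k\<in>UNIV. \<bar>a $ k\<bar>) * R))"
  proof (rule sum_mono)
    fix i
    have "\<bar>a \<bullet> x i\<bar> \<le> norm a * norm (x i)" by (rule Cauchy_Schwarz_ineq2)
    also have "\<dots> \<le> (\<Sum>k\<in>UNIV. \<bar>a $ k\<bar>) * R"
      by (intro mult_mono norm_le_l1_cart R[OF x(1)]) (auto intro: sum_nonneg)
    finally have "\<sigma> i * (a \<bullet> x i) \<le> (\<Sum>k\<in>UNIV. \<bar>a $ k\<bar>) * R"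
      by (simp add: \<sigma>_def abs_le_iff)
    then have "\<delta> * (\<sigma> i * (a \<bullet> x i)) \<le> \<delta> * ((\<Sum>k\<in>UNIV. \<bar>a $ k\<bar>) * R)"
      using \<delta> by (rule mult_left_mono)
    moreover have "a \<bullet> stretch i (\<xi> i) \<delta> (\<sigma> i *\<^sub>R x i) =
        (\<sigma> i * a $ i) * support_fun (K i) (\<xi> i) + \<delta> * (\<sigma> i * (a \<bullet> x i))"
      by (simp add: stretch_def inner_add_right x inner_axis)
    moreover have "\<sigma> i * a $ i = - \<bar>a $ i\<bar>" by (simp add: \<sigma>_def)
    ultimately show "a \<bullet> stretch i (\<xi> i) \<delta> (\<sigma> i *\<^sub>R x i) \<le>
        - (\<bar>a $ i\<bar> * support_fun (K i) (\<xi> i)) + \<delta> * ((\<Sum>k\<in>UNIV. \<bar>a $ k\<bar>) * R)"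
      by simp
  qed
  \<comment> \<open>The error term is the same for all n indices; in total each
    \<open>\<bar>a $ k\<bar>\<close> gets the factor \<open>\<delta> * (CARD('n) * R)\<close>,
    exactly the amount by which \<open>b\<close> was reduced.\<close>
  also have "\<dots> = (\<Sum>i\<in>UNIV. - (\<bar>a $ i\<bar> * b $ i))"
    by (simp add: b_def sum.distrib sum_negf right_diff_distrib sum_subtractf sum_distrib_left
        sum_distrib_right mult_ac)
  also have "\<dots> \<le> (\<Sum>i\<in>UNIV. a $ i * z $ i)"
  proof (rule sum_mono)
    fix i
    have "\<bar>z $ i\<bar> \<le> b $ i" using z(1) by (simp add: mem_box_cart abs_le_iff minus_le_iff)
    then have "\<bar>a $ i * z $ i\<bar> \<le> \<bar>a $ i\<bar> * b $ i" by (simp add: abs_mult mult_left_mono)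
    then show "- (\<bar>a $ i\<bar> * b $ i) \<le> a $ i * z $ i" by (simp add: abs_le_iff)
  qed
  also have "\<dots> = a \<bullet> z" by (simp add: inner_vec_def)
  finally show False using ac(1) by simp
qed

text \<open>The sum over all indices is squeezed between boxes converging to the one with half-sides
  \<open>support_fun (K i) (\<xi> i)\<close>. Sums over proper subsets flatten to volume 0, so a
  single term of the polarization survives.\<close>

proposition polar_volume_stretch_tendsto:
  assumes pos: "\<And>i. 0 < support_fun (K i) (\<xi> i)"
  shows "((\<lambda>\<delta>. polar_volume (\<lambda>i. stretch i (\<xi> i) \<delta> ` K i)) \<longlongrightarrow>
    (\<Prod>i\<in>UNIV. 2 * support_fun (K i) (\<xi> i)) / fact CARD('n)) (at_right 0)"
proof -
  let ?h = "\<lambda>i. support_fun (K i) (\<xi> i)"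
  let ?N = "CARD('n) * R"
  let ?v = "\<lambda>S \<delta>. measure lebesgue (\<Sum>i\<in>S. stretch i (\<xi> i) \<delta> ` K i)"
  have at0: "((\<lambda>\<delta>. \<delta>) \<longlongrightarrow> 0) (at_right (0::real))" by (rule tendsto_ident_at)
  have ev: "\<forall>\<^sub>F \<delta> in at_right 0. 0 < (\<delta>::real)" by (rule eventually_at_right_less)
  have comp_sum: "compact (\<Sum>i\<in>S. stretch i (\<xi> i) \<delta> ` K i)" for S \<delta>
    by (intro compact_set_sum compact_stretch comp)
  have upper: "?v S \<delta> \<le> (\<Prod>k\<in>UNIV. 2 * ((if k \<in> S then ?h k else 0) + \<delta> * ?N))" if "0 < \<delta>" for S \<delta>
  proof -
    let ?b = "\<chi> k. (if k \<in> S then ?h k else 0) + \<delta> * ?N"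
    have "?v S \<delta> \<le> measure lebesgue (cbox (- ?b) ?b)"
      using that stretch_sum_subset_cbox[of \<delta> S]
      by (intro measure_mono_fmeasurable fmeasurableD lmeasurable_compact comp_sum) auto
    also have "\<dots> = (\<Prod>k\<in>UNIV. 2 * ?b $ k)"
    proof (rule measure_cbox_uminus)
      have "0 \<le> \<delta> * ?N" using that R_nonneg by simp
      then show "0 \<le> ?b $ k" for k using less_imp_le[OF pos[of k]] by simp
    qed
    finally show ?thesis by simp
  qed
  have lim_upper: "((\<lambda>\<delta>. \<Prod>k\<in>UNIV. 2 * ((if k \<in> S then ?h k else 0) + \<delta> * ?N)) \<longlongrightarrow>
      (\<Prod>k\<in>UNIV. 2 * ((if k \<in> S then ?h k else 0) + 0 * ?N))) (at_right 0)" for S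
    by (intro tendsto_intros at0)
  have "(?v S \<longlongrightarrow> (if S = UNIV then \<Prod>k\<in>UNIV. 2 * ?h k else 0)) (at_right 0)" for S
  proof (cases "S = UNIV")
    case False
    \<comment> \<open>In this coordinate the enclosing box has a side proportional to
      \<open>\<delta>\<close>.\<close>
    then obtain k where "k \<notin> S" by blast
    then have zero: "(\<Prod>k\<in>UNIV. 2 * ((if k \<in> S then ?h k else 0) + 0 * ?N)) = 0"
      by (intro prod_zero) auto
    have "(?v S \<longlongrightarrow> 0) (at_right 0)"
    proof (rule tendsto_sandwich[OF _ _ tendsto_const lim_upper[of S, unfolded zero]])
      show "\<forall>\<^sub>F \<delta> in at_right 0. 0 \<le> ?v S \<delta>" by simp
      show "\<forall>\<^sub>F \<delta> in at_right 0. ?v S \<delta> \<le> (\<Prod>k\<in>UNIV. 2 * ((if k \<in> S then ?h k else 0) + \<delta> * ?N))"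
        by (rule eventually_mono[OF ev upper])
    qed
    with False show ?thesis by simp
  next
    case True
    have "(?v UNIV \<longlongrightarrow> (\<Prod>k\<in>UNIV. 2 * ?h k)) (at_right 0)"
    proof (rule tendsto_sandwich[where f = "\<lambda>\<delta>. \<Prod>k\<in>UNIV. 2 * (?h k - \<delta> * ?N)"
          and h = "\<lambda>\<delta>. \<Prod>k\<in>UNIV. 2 * (?h k + \<delta> * ?N)"])
      show "((\<lambda>\<delta>. \<Prod>k\<in>UNIV. 2 * (?h k + \<delta> * ?N)) \<longlongrightarrow> (\<Prod>k\<in>UNIV. 2 * ?h k)) (at_right 0)"
        using lim_upper[of UNIV] by simp
      show "\<forall>\<^sub>F \<delta> in at_right 0. ?v UNIV \<delta> \<le> (\<Prod>k\<in>UNIV. 2 * (?h k + \<delta> * ?N))"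
        using eventually_mono[OF ev upper[of _ UNIV]] by simp
      have "((\<lambda>\<delta>. \<Prod>k\<in>UNIV. 2 * (?h k - \<delta> * ?N)) \<longlongrightarrow> (\<Prod>k\<in>UNIV. 2 * (?h k - 0 * ?N))) (at_right 0)"
        by (intro tendsto_intros at0)
      then show "((\<lambda>\<delta>. \<Prod>k\<in>UNIV. 2 * (?h k - \<delta> * ?N)) \<longlongrightarrow> (\<Prod>k\<in>UNIV. 2 * ?h k)) (at_right 0)"
        by simp
      \<comment> \<open>The volume formula for the inner box requires nonnegative half-sides, which
        holds for small \<open>\<delta>\<close> because the support values are positive.\<close>
      have "\<forall>\<^sub>F \<delta> in at_right 0. 0 < ?h k - \<delta> * ?N" for k
      proof (rule order_tendstoD(1))
        show "((\<lambda>\<delta>. ?h k - \<delta> * ?N) \<longlongrightarrow> ?h k - 0 * ?N) (at_right 0)"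
          by (intro tendsto_intros at0)
        show "0 < ?h k - 0 * ?N" using pos by simp
      qed
      then have "\<forall>\<^sub>F \<delta> in at_right 0. \<forall>k. 0 < ?h k - \<delta> * ?N"
        by (intro eventually_all_finite)
      then show "\<forall>\<^sub>F \<delta> in at_right 0. (\<Prod>k\<in>UNIV. 2 * (?h k - \<delta> * ?N)) \<le> ?v UNIV \<delta>"
        using ev
      proof eventually_elim
        fix \<delta> :: real assume le: "\<forall>k. 0 < ?h k - \<delta> * ?N" and "0 < \<delta>"
        let ?b = "\<chi> k. ?h k - \<delta> * ?N"
        have "(\<Prod>k\<in>UNIV. 2 * ?b $ k) = measure lebesgue (cbox (- ?b) ?b)"
          using le by (intro measure_cbox_uminus[symmetric]) (simp add: less_imp_le)
        also have "\<dots> \<le> ?v UNIV \<delta>"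
          using \<open>0 < \<delta>\<close> cbox_subset_stretch_sum[of \<delta>]
          by (intro measure_mono_fmeasurable fmeasurableD lmeasurable_compact comp_sum) auto
        finally show "(\<Prod>k\<in>UNIV. 2 * (?h k - \<delta> * ?N)) \<le> ?v UNIV \<delta>" by simp
      qed
    qed
    with True show ?thesis by simp
  qed
  then have "((\<lambda>\<delta>. polar_volume (\<lambda>i. stretch i (\<xi> i) \<delta> ` K i)) \<longlongrightarrow>
      polar (\<lambda>S::'n set. if S = UNIV then \<Prod>k\<in>UNIV. 2 * ?h k else 0)) (at_right 0)"
    unfolding polar_volume_def by (rule polar_tendsto)
  moreover have "polar (\<lambda>S::'n set. if S = UNIV then \<Prod>k\<in>UNIV. 2 * ?h k else 0) =
      (\<Prod>i\<in>UNIV. 2 * ?h i) / fact CARD('n)"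
    by (simp add: polar_def if_distrib cong: if_cong)
  ultimately show ?thesis by simp
qed

end

section \<open>From the hypothesis on determinant one to support functions\<close>

lemma convex_body_linear_image:
  fixes f :: "real^'n::finite \<Rightarrow> real^'n"
  assumes "convex_body K" "det (matrix f) \<noteq> 0" "linear f"
  shows "convex_body (f ` K)"
proof -
  have surj: "surj f"
    using assms(2) det_nz_iff_inj[OF assms(3)] linear_injective_imp_surjective[OF assms(3)] by blast
  have "f ` interior K \<subseteq> interior (f ` K)"
    by (intro interior_maximal image_mono interior_subset open_surjective_linear_image assms(3) surj) simp
  moreover have "continuous_on K f"
    using assms(3) by (simp add: linear_continuous_on linear_conv_bounded_linear)
  ultimately show ?thesis
    using assms by (auto simp: convex_body_def compact_continuous_image convex_linear_image)
qed

lemma det_scaleR_matrix: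
  fixes A :: "real^'n::finite^'n"
  shows "det (c *\<^sub>R A) = c ^ CARD('n) * det A"
proof -
  have "c *\<^sub>R A = (\<chi> i. c *s A $ i)"
    by (simp add: vec_eq_iff)
  then show ?thesis by (simp add: det_rows_mul)
qed

text \<open>Scaling each \<open>f i\<close> to determinant one multiplies both polarized volumes by
  the same positive factor, which cancels.\<close>

lemma polar_volume_le_of_SL:
  fixes A B :: "'n::finite \<Rightarrow> (real^'n) set"
  assumes A: "\<And>i. convex_body (A i)" and B: "\<And>i. convex_body (B i)"
    and SL: "\<And>u :: 'n \<Rightarrow> real^'n^'n. (\<And>i. det (u i) = 1) \<Longrightarrow>
           mixed_volume (\<lambda>i. (*v) (u i) ` A i) \<le> mixed_volume (\<lambda>i. (*v) (u i) ` B i)"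
    and f: "\<And>i. linear (f i)" "\<And>i. 0 < det (matrix (f i))"
  shows "polar_volume (\<lambda>i. f i ` A i) \<le> polar_volume (\<lambda>i. f i ` B i)"
proof -
  \<comment> \<open>Scaling by \<open>a i\<close> multiplies the determinant by
    \<open>a i ^ CARD('n)\<close>, hence the root.\<close>
  define a where "a i = 1 / root CARD('n) (det (matrix (f i)))" for i
  define u where "u i = a i *\<^sub>R matrix (f i)" for i
  have a: "0 < a i" for i using f(2)[of i] by (simp add: a_def)
  have det: "det (u i) = 1" for i
    using f(2)[of i] by (simp add: u_def det_scaleR_matrix a_def power_one_over)
  have fK: "convex_body (f i ` K)" if "convex_body K" for i K
    using convex_body_linear_image[OF that _ f(1)] f(2)[of i] by simp
  have img: "(*v) (u i) ` K = (*\<^sub>R) (a i) ` f i ` K" for i K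
    by (simp add: u_def image_image scaleR_matrix_vector_assoc[symmetric] 
        matrix_works[OF f(1)[unfolded linear_matrix_vector_mul_eq[symmetric]]])
  have mv: "mixed_volume (\<lambda>i. (*v) (u i) ` K i) = (\<Prod>i\<in>UNIV. a i) * polar_volume (\<lambda>i. f i ` K i)"
    if K: "\<And>i. convex_body (K i)" for K
  proof -
    have "convex_body ((*v) (u i) ` K i)" for i
      using det[of i] by (intro convex_body_linear_image K) auto
    then have "mixed_volume (\<lambda>i. (*v) (u i) ` K i) = polar_volume (\<lambda>i. (*v) (u i) ` K i)"
      by (rule mixed_volume_eq_polar_volume)
    also have "\<dots> = (\<Prod>i\<in>UNIV. a i) * polar_volume (\<lambda>i. f i ` K i)"
      unfolding img by (rule polar_volume_scale) (use a K fK in \<open>auto intro: less_imp_le\<close>)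
    finally show ?thesis .
  qed
  have "0 < (\<Prod>i\<in>UNIV. a i)" by (intro prod_pos) (simp add: a)
  moreover have "mixed_volume (\<lambda>i. (*v) (u i) ` A i) \<le> mixed_volume (\<lambda>i. (*v) (u i) ` B i)"
    using det by (rule SL)
  ultimately show ?thesis unfolding mv[OF A] mv[OF B] by simp
qed

text \<open>The inequality for the stretched bodies passes to the limit \<open>\<delta>\<close> to
  0, where the powers of 2 and the factorial cancel.\<close>

lemma prod_support_fun_le:
  fixes A B :: "'n::finite \<Rightarrow> (real^'n) set"
  assumes A: "\<And>i. convex_body (A i)" "\<And>i. centrally_symmetric (A i)"
    and B: "\<And>i. convex_body (B i)" "\<And>i. centrally_symmetric (B i)"
    and SL: "\<And>u :: 'n \<Rightarrow> real^'n^'n. (\<And>i. det (u i) = 1) \<Longrightarrow>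
           mixed_volume (\<lambda>i. (*v) (u i) ` A i) \<le> mixed_volume (\<lambda>i. (*v) (u i) ` B i)"
    and pos: "\<And>i. 0 < support_fun (A i) (\<xi> i)" "\<And>i. 0 < support_fun (B i) (\<xi> i)"
  shows "(\<Prod>i\<in>UNIV. support_fun (A i) (\<xi> i)) \<le> (\<Prod>i\<in>UNIV. support_fun (B i) (\<xi> i))"
proof -
  \<comment> \<open>The sign is flipped to make the determinant of the stretch positive; support
    functions of symmetric bodies are even, so no value changes.\<close>
  define \<eta> where "\<eta> i = (if 0 \<le> \<xi> i $ i then \<xi> i else - \<xi> i)" for i
  have eq: "support_fun (A i) (\<eta> i) = support_fun (A i) (\<xi> i)"
    "support_fun (B i) (\<eta> i) = support_fun (B i) (\<xi> i)" for i
    by (simp_all add: \<eta>_def support_fun_uminus A B)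
  have \<eta>: "0 \<le> \<eta> i $ i" for i by (simp add: \<eta>_def)
  have bounded: "\<exists>R. \<forall>i. \<forall>x\<in>K i. norm x \<le> R" if "\<And>i. convex_body (K i)" for K :: "'n \<Rightarrow> (real^'n) set"
  proof -
    have "bounded (\<Union>i. K i)"
      using that by (intro bounded_UN) (auto intro: compact_imp_bounded convex_body_imp_compact)
    then show ?thesis by (auto simp: bounded_iff)
  qed
  obtain R R' where R: "\<And>i x. x \<in> A i \<Longrightarrow> norm x \<le> R" "\<And>i x. x \<in> B i \<Longrightarrow> norm x \<le> R'"
    using bounded[of A, OF A(1)] bounded[of B, OF B(1)] by metis
  have "((\<lambda>\<delta>. polar_volume (\<lambda>i. stretch i (\<eta> i) \<delta> ` A i)) \<longlongrightarrow>
      (\<Prod>i\<in>UNIV. 2 * support_fun (A i) (\<eta> i)) / fact CARD('n)) (at_right 0)"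
    by (rule polar_volume_stretch_tendsto[OF A R(1)]) (simp_all add: eq pos)
  moreover have "((\<lambda>\<delta>. polar_volume (\<lambda>i. stretch i (\<eta> i) \<delta> ` B i)) \<longlongrightarrow>
      (\<Prod>i\<in>UNIV. 2 * support_fun (B i) (\<eta> i)) / fact CARD('n)) (at_right 0)"
    by (rule polar_volume_stretch_tendsto[OF B R(2)]) (simp_all add: eq pos)
  moreover have "\<forall>\<^sub>F \<delta> in at_right 0. polar_volume (\<lambda>i. stretch i (\<eta> i) \<delta> ` A i) \<le>
      polar_volume (\<lambda>i. stretch i (\<eta> i) \<delta> ` B i)"
    using eventually_at_right_less
  proof eventually_elim
    fix \<delta> :: real assume "0 < \<delta>"
    then show "polar_volume (\<lambda>i. stretch i (\<eta> i) \<delta> ` A i) \<le> polar_volume (\<lambda>i. stretch i (\<eta> i) \<delta> ` B i)"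
      using \<eta> by (intro polar_volume_le_of_SL A B SL linear_stretch det_stretch_pos)
  qed
  ultimately have "(\<Prod>i\<in>UNIV. 2 * support_fun (A i) (\<eta> i)) / fact CARD('n) \<le>
      (\<Prod>i\<in>UNIV. 2 * support_fun (B i) (\<eta> i)) / fact CARD('n)"
    by (intro tendsto_le[OF trivial_limit_at_right_real])
  then show ?thesis
    by (simp add: eq divide_le_cancel prod.distrib)
qed

section \<open>Optimal inclusion factors\<close>

text \<open>\<open>s\<close> is the supremum of the ratio of support functions, finite because
  \<open>A\<close> is bounded and \<open>B\<close> contains a ball. A sequence of directions
  approaching it is enough for passing product inequalities to the limit.\<close>

lemma support_ratio_sup:
  fixes A B :: "'a::euclidean_space set"
  assumes A: "convex_body A" "centrally_symmetric A" and B: "convex_body B" "centrally_symmetric B"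
  obtains s \<xi> where "0 < s" "A \<subseteq> (*\<^sub>R) s ` B"
    "\<And>k. 0 < support_fun A (\<xi> k)" "\<And>k. 0 < support_fun B (\<xi> k)"
    "(\<lambda>k::nat. support_fun A (\<xi> k) / support_fun B (\<xi> k)) \<longlonglongrightarrow> s"
proof -
  have comp: "compact A" "compact B" "convex B" "A \<noteq> {}" "B \<noteq> {}"
    using A B by (auto simp: convex_body_def)
  obtain r where r: "0 < r" "cball 0 r \<subseteq> A" using symmetric_convex_body_cball[OF A] .
  obtain q where q: "0 < q" "cball 0 q \<subseteq> B" using symmetric_convex_body_cball[OF B] .
  obtain R where R: "\<And>x. x \<in> A \<Longrightarrow> norm x \<le> R"
    using compact_imp_bounded[OF comp(1)] by (auto simp: bounded_iff)
  have posA: "0 < support_fun A \<xi>" and lowB: "q * norm \<xi> \<le> support_fun B \<xi>"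
    and posB: "0 < support_fun B \<xi>" if "\<xi> \<noteq> 0" for \<xi>
  proof -
    show "q * norm \<xi> \<le> support_fun B \<xi>"
      by (rule support_fun_ge_norm[OF comp(2) q(2) less_imp_le[OF q(1)]])
    moreover have "0 < q * norm \<xi>" using q(1) that by simp
    ultimately show "0 < support_fun B \<xi>" by linarith
    have "r * norm \<xi> \<le> support_fun A \<xi>"
      by (rule support_fun_ge_norm[OF comp(1) r(2) less_imp_le[OF r(1)]])
    moreover have "0 < r * norm \<xi>" using r(1) that by simp
    ultimately show "0 < support_fun A \<xi>" by linarith
  qed
  define X where "X = (\<lambda>\<xi>. support_fun A \<xi> / support_fun B \<xi>) ` (- {0})"
  define s where "s = Sup X"
  have "support_fun A \<xi> / support_fun B \<xi> \<le> R / q" if "\<xi> \<noteq> 0" for \<xi>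
  proof -
    obtain x where "x \<in> A" "\<xi> \<bullet> x = support_fun A \<xi>"
      by (rule support_fun_attained[OF comp(1,4), of \<xi>])
    then have "support_fun A \<xi> \<le> norm \<xi> * norm x"
      using norm_cauchy_schwarz[of \<xi> x] by simp
    also have "\<dots> \<le> norm \<xi> * R"
      using R[OF \<open>x \<in> A\<close>] by (rule mult_left_mono) simp
    finally have le: "support_fun A \<xi> \<le> norm \<xi> * R" .
    have "support_fun A \<xi> / support_fun B \<xi> \<le> (norm \<xi> * R) / (q * norm \<xi>)"
    proof (rule frac_le)
      show "0 \<le> norm \<xi> * R" using posA[OF that] le by simp
      show "0 < q * norm \<xi>" using q(1) that by simp
      show "q * norm \<xi> \<le> support_fun B \<xi>" using that by (rule lowB)
    qed (rule le)
    then show ?thesis using that by (simp add: mult.commute)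
  qed
  then have bdd: "bdd_above X" unfolding X_def by (intro bdd_aboveI[of _ "R / q"]) auto
  obtain e :: 'a where "e \<in> Basis" using nonempty_Basis by blast
  then have e: "e \<noteq> 0" by (rule nonzero_Basis)
  have ne: "X \<noteq> {}" using e unfolding X_def by blast
  have upper: "support_fun A \<xi> \<le> s * support_fun B \<xi>" if "\<xi> \<noteq> 0" for \<xi>
  proof -
    have "support_fun A \<xi> / support_fun B \<xi> \<le> s"
      unfolding s_def by (rule cSup_upper[OF _ bdd]) (use that in \<open>simp add: X_def\<close>)
    then show ?thesis using posB[OF that] by (simp add: pos_divide_le_eq)
  qed
  have "0 < s"
  proof -
    have "0 < s * support_fun B e" using posA[OF e] upper[OF e] by (rule less_le_trans)
    then show ?thesis using posB[OF e] by (rule zero_less_mult_pos2)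
  qed
  have "s \<in> closure X" unfolding s_def by (rule closure_contains_Sup[OF ne bdd])
  then obtain y where y: "\<And>k. y k \<in> X" "y \<longlonglongrightarrow> s"
    unfolding closure_sequential by blast
  have "\<exists>\<xi>. \<xi> \<noteq> 0 \<and> y k = support_fun A \<xi> / support_fun B \<xi>" for k
    using y(1)[of k] unfolding X_def by blast
  then obtain \<xi> where \<xi>: "\<And>k. \<xi> k \<noteq> 0" "\<And>k. y k = support_fun A (\<xi> k) / support_fun B (\<xi> k)"
    by metis
  show thesis
  proof (rule that[OF \<open>0 < s\<close> _ posA[OF \<xi>(1)] posB[OF \<xi>(1)]])
    show "A \<subseteq> (*\<^sub>R) s ` B" by (rule subset_scaleR_of_support_fun_le[OF comp(1,2,3,5) upper])
    show "(\<lambda>k. support_fun A (\<xi> k) / support_fun B (\<xi> k)) \<longlonglongrightarrow> s"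
      using y(2) by (simp add: \<xi>(2)[symmetric])
  qed
qed

text \<open>\<open>B\<close> is convex and contains the origin, so it contains its own contraction
  by \<open>s / t\<close>.\<close>

lemma scaleR_image_mono:
  fixes B :: "'a::euclidean_space set"
  assumes "convex_body B" "centrally_symmetric B" "0 \<le> s" "s \<le> t" "0 < t"
  shows "(*\<^sub>R) s ` B \<subseteq> (*\<^sub>R) t ` B"
proof (rule image_subsetI)
  fix x assume x: "x \<in> B"
  obtain r where "0 < r" "cball 0 r \<subseteq> B" using symmetric_convex_body_cball[OF assms(1,2)] .
  then have "0 \<in> B" by auto
  then have "(s / t) *\<^sub>R x + (1 - s / t) *\<^sub>R 0 \<in> B"
    using assms x by (intro convexD) (auto simp: convex_body_def)
  then have "(s / t) *\<^sub>R x \<in> B" by simp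
  then have "t *\<^sub>R (s / t) *\<^sub>R x \<in> (*\<^sub>R) t ` B" by (rule imageI)
  then show "s *\<^sub>R x \<in> (*\<^sub>R) t ` B" using assms by simp
qed

theorem theorem4p2:
  fixes A B :: "'n::finite \<Rightarrow> (real^'n) set"
  assumes "\<And>i. convex_body (A i)" and "\<And>i. centrally_symmetric (A i)"
    and "\<And>i. convex_body (B i)" and "\<And>i. centrally_symmetric (B i)"
    and "\<And>u :: 'n \<Rightarrow> real^'n^'n. (\<And>i. det (u i) = 1) \<Longrightarrow>
           mixed_volume (\<lambda>i. (*v) (u i) ` A i) \<le> mixed_volume (\<lambda>i. (*v) (u i) ` B i)"
  shows "\<exists>t :: 'n \<Rightarrow> real. (\<forall>i. 0 < t i) \<and> (\<Prod>i\<in>UNIV. t i) = 1 \<and>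
           (\<forall>i. A i \<subseteq> (*\<^sub>R) (t i) ` B i)"
proof -
  define Q where "Q i s \<xi> \<longleftrightarrow> 0 < s \<and> A i \<subseteq> (*\<^sub>R) s ` B i \<and>
      (\<forall>k. 0 < support_fun (A i) (\<xi> k)) \<and> (\<forall>k. 0 < support_fun (B i) (\<xi> k)) \<and>
      (\<lambda>k::nat. support_fun (A i) (\<xi> k) / support_fun (B i) (\<xi> k)) \<longlonglongrightarrow> s" for i s \<xi>
  have "\<exists>s \<xi>. Q i s \<xi>" for i
    by (rule support_ratio_sup[OF assms(1,2,3,4)[of i]]) (auto simp: Q_def)
  then obtain s \<xi> where Q: "\<And>i. Q i (s i) (\<xi> i)" by metis
  have s: "0 < s i" "A i \<subseteq> (*\<^sub>R) (s i) ` B i"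
    and pos: "0 < support_fun (A i) (\<xi> i k)" "0 < support_fun (B i) (\<xi> i k)"
    and lim: "(\<lambda>k. support_fun (A i) (\<xi> i k) / support_fun (B i) (\<xi> i k)) \<longlonglongrightarrow> s i" for i k
    using Q[of i] by (simp_all add: Q_def)
  define p where "p = (\<Prod>i\<in>UNIV. s i)"
  have "0 < p" unfolding p_def by (intro prod_pos) (simp add: s)
  have "(\<lambda>k. \<Prod>i\<in>UNIV. support_fun (A i) (\<xi> i k) / support_fun (B i) (\<xi> i k)) \<longlonglongrightarrow> p"
    unfolding p_def by (intro tendsto_prod lim)
  \<comment> \<open>The directions may be chosen independently for each \<open>i\<close>, so the
    \<open>k\<close>-th members of all the sequences can be used at once.\<close>
  moreover have "(\<Prod>i\<in>UNIV. support_fun (A i) (\<xi> i k) / support_fun (B i) (\<xi> i k)) \<le> 1" for k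
  proof -
    have "(\<Prod>i\<in>UNIV. support_fun (A i) (\<xi> i k)) \<le> (\<Prod>i\<in>UNIV. support_fun (B i) (\<xi> i k))"
      by (rule prod_support_fun_le[OF assms pos])
    moreover have "0 < (\<Prod>i\<in>UNIV. support_fun (B i) (\<xi> i k))"
      by (intro prod_pos) (simp add: pos)
    ultimately show ?thesis by (simp add: prod_dividef)
  qed
  ultimately have "p \<le> 1" by (intro LIMSEQ_le_const2) auto
  \<comment> \<open>The product of the \<open>s i\<close> is \<open>p\<close>, at most 1. Enlarging
    every factor by the n-th root of \<open>1 / p\<close>, which is at least 1, makes the product 1
    and keeps the inclusions.\<close>
  define c where "c = root CARD('n) (1 / p)"
  have c: "c ^ CARD('n) = 1 / p" "1 \<le> c"
    using \<open>0 < p\<close> \<open>p \<le> 1\<close> by (simp_all add: c_def)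
  define t where "t i = s i * c" for i
  have t: "0 < t i" "s i \<le> t i" for i
    using s(1)[of i] c(2) by (auto simp: t_def intro!: mult_pos_pos)
  have "(\<Prod>i\<in>UNIV. t i) = 1"
    using \<open>0 < p\<close> by (simp add: t_def prod.distrib c p_def[symmetric])
  moreover have "A i \<subseteq> (*\<^sub>R) (t i) ` B i" for i
    using s(2) scaleR_image_mono[OF assms(3,4) less_imp_le[OF s(1)] t(2,1)] by (rule subset_trans)
  ultimately show ?thesis using t(1) by blast
qed

end
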